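(* Suppose that $\alpha,\beta\in S_G^p(0,T)$ for some $p\geq 1$. Define the process $\gamma$ by $$\gamma_t:=\sup_{s\in[0,t]}\left[\alpha_s\wedge \left(\inf_{r\in[s,t]}\beta_r\right)\right],\qquad t\in[0,T].$$ Then $\gamma\in S_G^p(0,T)$.
   Context: Fix $T>0$. $\Omega_T=C_0([0,T];\mathbb{R})$ is the space of real continuous functions on $[0,T]$ vanishing at $0$, with the supremum norm; $B$ is the canonical process. Fix $0\le\underline{\sigma}^2<\bar{\sigma}^2$ and set $G(a)=\frac12(\bar{\sigma}^2a^+-\underline{\sigma}^2a^-)$. $C_{l,Lip}(\mathbb{R}^n)$ is the set of functions $\varphi$ with $|\varphi(x)-\varphi(y)|\le C(1+|x|^k+|y|^k)|x-y|$ for some $C,k$; $C_{b,Lip}(\mathbb{R}^n)$ is the set of bounded Lipschitz functions. $L_{ip}(\Omega_t)=\{\varphi(B_{t_1},\dots,B_{t_n}): n\in\mathbb{N},\ t_1,\dots,t_n\in[0,t],\ \varphi\in C_{l,Lip}(\mathbb{R}^n)\}$. $\hat{\mathbb{E}}:L_{ip}(\Omega_T)\to\mathbb{R}$ is the $G$-expectation, i.e. the sublinear expectation such that for $0\le s\le t\le T$ and $\varphi\in C_{l,Lip}(\mathbb{R})$, $\hat{\mathbb{E}}[\varphi(x+B_t-B_s)]=u(t-s,x)$ where $u$ is the viscosity solution of $\partial_tu-G(\partial_x^2u)=0$, $u(0,\cdot)=\varphi$, and for $0\le t_1\le\dots\le t_n\le T$, $\varphi\in C_{l,Lip}(\mathbb{R}^n)$,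 $\hat{\mathbb{E}}[\varphi(B_{t_1},\dots,B_{t_{n-1}},B_{t_n}-B_{t_{n-1}})]=\hat{\mathbb{E}}[\psi(B_{t_1},\dots,B_{t_{n-1}})]$ with $\psi(x_1,\dots,x_{n-1})=\hat{\mathbb{E}}[\varphi(x_1,\dots,x_{n-1},B_{t_n}-B_{t_{n-1}})]$. For $p\ge1$, $L_G^p(\Omega_T)$ is the completion of $L_{ip}(\Omega_T)$ under $(\hat{\mathbb{E}}[|\xi|^p])^{1/p}$, to which $\hat{\mathbb E}$ extends. There is a weakly compact set $\mathcal{P}$ of probability measures on $(\Omega_T,\mathcal{B}(\Omega_T))$ (fixed) with $\hat{\mathbb{E}}[\xi]=\sup_{P\in\mathcal{P}}E_P[\xi]$ for $\xi\in L_G^1(\Omega_T)$. A Borel set $A$ is polar if $\sup_{P\in\mathcal{P}}P(A)=0$; a property holds quasi-surely (q.s.) if it holds outside a polar set; random variables equal q.s. are identified. $S_G^0(0,T)=\{h(t,B_{t_1\wedge t},\dots,B_{t_n\wedge t}): t_1,\dots,t_n\in[0,T],\ h\in C_{b,Lip}(\mathbb{R}^{n+1})\}$ and, for $p\ge1$, $S_G^p(0,T)$ is the completion of $S_G^0(0,T)$ under $\|\eta\|_{S_G^p}=(\hat{\mathbb{E}}[\sup_{t\in[0,T]}|\eta_t|^p])^{1/p}$. $a\wedge b=\min(a,b)$. *)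

theory Defs
  imports "HOL-Probability.Probability"
begin

section \<open>Path space and weak topology\<close>

text \<open>A continuous path on \<open>[0,T]\<close> is represented by its continuous extension to \<open>\<real>\<close> that is
  constant on \<open>(-\<infinity>,0]\<close> and on \<open>[T,\<infinity>)\<close>. This is an isometry for the supremum norms, so the metric
  and Borel structure inherited from bounded continuous functions are those of \<open>C\<^sub>0([0,T])\<close>. The
  canonical process at time \<open>t\<close> is \<open>\<lambda>w. w t\<close>, via the coercion \<open>apply_bcontfun\<close>.\<close>

type_synonym path = "real \<Rightarrow>\<^sub>C real"

definition path_space :: "real \<Rightarrow> path set" where
  "path_space T = {w :: path. w 0 = 0 \<and> (\<forall>t\<le>0. w t = w 0) \<and> (\<forall>t\<ge>T. w t = w T)}"

definition path_borel :: "real \<Rightarrow> path measure" where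
  "path_borel T = restrict_space borel (path_space T)"

definition path_probs :: "real \<Rightarrow> path measure set" where
  "path_probs T = {Q. prob_space Q \<and> sets Q = sets (path_borel T)}"

text \<open>Coarsest topology making \<open>Q \<mapsto> E\<^sub>Q[f]\<close> continuous for every bounded continuous \<open>f\<close>.\<close>

definition weak_topology :: "real \<Rightarrow> path measure topology" where
  "weak_topology T = topology_generated_by
     {{Q \<in> path_probs T. (LINT w|Q. f w) \<in> U} | (f :: path \<Rightarrow> real) U.
        continuous_on (path_space T) f \<and> bounded (f ` path_space T) \<and> open U}"

definition polar :: "real \<Rightarrow> path measure set \<Rightarrow> path set \<Rightarrow> bool" where
  "polar T \<P> A \<longleftrightarrow> A \<in> sets (path_borel T) \<and> (SUP Q\<in>\<P>. emeasure Q A) = 0"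

definition quasi_surely :: "real \<Rightarrow> path measure set \<Rightarrow> (path \<Rightarrow> bool) \<Rightarrow> bool" where
  "quasi_surely T \<P> \<Phi> \<longleftrightarrow> (\<exists>N. polar T \<P> N \<and> (\<forall>w\<in>path_space T - N. \<Phi> w))"

section \<open>Cylinder random variables\<close>

text \<open>A point of \<open>\<real>\<^sup>n\<close> is a list of length \<open>n\<close>; functions on \<open>\<real>\<^sup>n\<close> are functions on lists whose
  values on lists of other lengths are irrelevant.\<close>

definition eucl_norm :: "real list \<Rightarrow> real" where
  "eucl_norm x = L2_set (\<lambda>i. x ! i) {..<length x}"

definition eucl_dist :: "real list \<Rightarrow> real list \<Rightarrow> real" where
  "eucl_dist x y = L2_set (\<lambda>i. x ! i - y ! i) {..<length x}"

definition C_lLip :: "nat \<Rightarrow> (real list \<Rightarrow> real) set" where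
  "C_lLip n = {\<phi>. \<exists>C (k::nat). \<forall>x y. length x = n \<longrightarrow> length y = n \<longrightarrow>
     \<bar>\<phi> x - \<phi> y\<bar> \<le> C * (1 + eucl_norm x ^ k + eucl_norm y ^ k) * eucl_dist x y}"

definition C_bLip :: "nat \<Rightarrow> (real list \<Rightarrow> real) set" where
  "C_bLip n = {\<phi>. (\<exists>M. \<forall>x. length x = n \<longrightarrow> \<bar>\<phi> x\<bar> \<le> M) \<and>
     (\<exists>L. \<forall>x y. length x = n \<longrightarrow> length y = n \<longrightarrow> \<bar>\<phi> x - \<phi> y\<bar> \<le> L * eucl_dist x y)}"

text \<open>\<open>Lip T t\<close> is \<open>L\<^sub>i\<^sub>p(\<Omega>\<^sub>t)\<close> on the path space over \<open>[0,T]\<close>.\<close>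

definition Lip :: "real \<Rightarrow> real \<Rightarrow> (path \<Rightarrow> real) set" where
  "Lip T t = {\<xi>. \<exists>ts \<phi>. set ts \<subseteq> {0..t} \<and> \<phi> \<in> C_lLip (length ts) \<and>
     (\<forall>w\<in>path_space T. \<xi> w = \<phi> (map (apply_bcontfun w) ts))}"

section \<open>The G-heat equation and the G-expectation\<close>

definition G_fun :: "real \<Rightarrow> real \<Rightarrow> real \<Rightarrow> real" where
  "G_fun \<sigma>l \<sigma>u a = (\<sigma>u\<^sup>2 * max a 0 - \<sigma>l\<^sup>2 * max (- a) 0) / 2"

definition C12_derivs ::
    "(real \<Rightarrow> real \<Rightarrow> real) \<Rightarrow> (real \<Rightarrow> real \<Rightarrow> real) \<Rightarrow> (real \<Rightarrow> real \<Rightarrow> real) \<Rightarrow> (real \<Rightarrow> real \<Rightarrow> real) \<Rightarrow> bool"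
where
  "C12_derivs \<psi> \<psi>t \<psi>x \<psi>xx \<longleftrightarrow>
     (\<forall>t>0. \<forall>x. ((\<lambda>s. \<psi> s x) has_real_derivative \<psi>t t x) (at t) \<and>
                (\<psi> t has_real_derivative \<psi>x t x) (at x) \<and>
                (\<psi>x t has_real_derivative \<psi>xx t x) (at x)) \<and>
     (\<forall>f\<in>{\<psi>, \<psi>t, \<psi>x, \<psi>xx}. continuous_on ({0<..} \<times> UNIV) (\<lambda>(t, x). f t x))"

definition viscosity_subsolution :: "(real \<Rightarrow> real) \<Rightarrow> (real \<Rightarrow> real \<Rightarrow> real) \<Rightarrow> bool" where
  "viscosity_subsolution G u \<longleftrightarrow>
     (\<forall>\<psi> \<psi>t \<psi>x \<psi>xx t x. C12_derivs \<psi> \<psi>t \<psi>x \<psi>xx \<longrightarrow> t > 0 \<longrightarrow>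
        \<psi> t x = u t x \<longrightarrow> (\<forall>s>0. \<forall>y. u s y \<le> \<psi> s y) \<longrightarrow> \<psi>t t x - G (\<psi>xx t x) \<le> 0)"

definition viscosity_supersolution :: "(real \<Rightarrow> real) \<Rightarrow> (real \<Rightarrow> real \<Rightarrow> real) \<Rightarrow> bool" where
  "viscosity_supersolution G u \<longleftrightarrow>
     (\<forall>\<psi> \<psi>t \<psi>x \<psi>xx t x. C12_derivs \<psi> \<psi>t \<psi>x \<psi>xx \<longrightarrow> t > 0 \<longrightarrow>
        \<psi> t x = u t x \<longrightarrow> (\<forall>s>0. \<forall>y. \<psi> s y \<le> u s y) \<longrightarrow> \<psi>t t x - G (\<psi>xx t x) \<ge> 0)"

text \<open>The viscosity solution is understood in the usual uniqueness class of continuous functions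
  with polynomial growth in \<open>x\<close>, locally uniformly in \<open>t\<close>.\<close>

definition viscosity_solution ::
    "(real \<Rightarrow> real) \<Rightarrow> (real \<Rightarrow> real) \<Rightarrow> (real \<Rightarrow> real \<Rightarrow> real) \<Rightarrow> bool" where
  "viscosity_solution G \<phi> u \<longleftrightarrow>
     continuous_on ({0..} \<times> UNIV) (\<lambda>(t, x). u t x) \<and>
     (\<forall>\<tau>. \<exists>C (k::nat). \<forall>t\<in>{0..\<tau>}. \<forall>x. \<bar>u t x\<bar> \<le> C * (1 + \<bar>x\<bar> ^ k)) \<and>
     viscosity_subsolution G u \<and> viscosity_supersolution G u \<and> (\<forall>x. u 0 x = \<phi> x)"

definition sublinear_expectation :: "real \<Rightarrow> ((path \<Rightarrow> real) \<Rightarrow> real) \<Rightarrow> bool" where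
  "sublinear_expectation T E \<longleftrightarrow>
     (\<forall>X\<in>Lip T T. \<forall>Y\<in>Lip T T. (\<forall>w\<in>path_space T. X w \<le> Y w) \<longrightarrow> E X \<le> E Y) \<and>
     (\<forall>c. E (\<lambda>w. c) = c) \<and>
     (\<forall>X\<in>Lip T T. \<forall>Y\<in>Lip T T. E (\<lambda>w. X w + Y w) \<le> E X + E Y) \<and>
     (\<forall>X\<in>Lip T T. \<forall>c\<ge>0. E (\<lambda>w. c * X w) = c * E X)"

text \<open>In the last clause \<open>ts @ [s, t]\<close> is the increasing sequence of times \<open>t\<^sub>1, \<dots>, t\<^sub>n\<close> with
  \<open>n \<ge> 2\<close>, so \<open>s\<close> and \<open>t\<close> are its last two members.\<close>

definition G_expectation :: "real \<Rightarrow> real \<Rightarrow> real \<Rightarrow> ((path \<Rightarrow> real) \<Rightarrow> real) \<Rightarrow> bool" where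
  "G_expectation \<sigma>l \<sigma>u T E \<longleftrightarrow>
     sublinear_expectation T E \<and>
     (\<forall>\<phi>\<in>C_lLip 1. \<exists>u. viscosity_solution (G_fun \<sigma>l \<sigma>u) (\<lambda>x. \<phi> [x]) u \<and>
        (\<forall>s t x. 0 \<le> s \<longrightarrow> s \<le> t \<longrightarrow> t \<le> T \<longrightarrow> E (\<lambda>w :: path. \<phi> [x + w t - w s]) = u (t - s) x)) \<and>
     (\<forall>ts s t. \<forall>\<phi>\<in>C_lLip (length ts + 2).
        sorted (ts @ [s, t]) \<longrightarrow> set (ts @ [s, t]) \<subseteq> {0..T} \<longrightarrow>
        E (\<lambda>w. \<phi> (map (apply_bcontfun w) (ts @ [s]) @ [w t - w s])) =
        E (\<lambda>w. (\<lambda>x. E (\<lambda>w'. \<phi> (x @ [w' t - w' s]))) (map (apply_bcontfun w) (ts @ [s]))))"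

section \<open>The completions\<close>

definition LG_norm :: "((path \<Rightarrow> real) \<Rightarrow> real) \<Rightarrow> real \<Rightarrow> (path \<Rightarrow> real) \<Rightarrow> real" where
  "LG_norm E p X = E (\<lambda>w. \<bar>X w\<bar> powr p) powr (1 / p)"

text \<open>An element of the completion is a class of Cauchy sequences of cylinder variables modulo null
  sequences. Each class contains a quasi-surely convergent sequence, and its quasi-sure limit
  determines the class, so the element is realised as that random variable, defined up to
  quasi-sure equality. The same applies to processes below, with quasi-sure uniform convergence
  on \<open>[0,T]\<close>.\<close>

definition LG_approx ::
    "real \<Rightarrow> ((path \<Rightarrow> real) \<Rightarrow> real) \<Rightarrow> path measure set \<Rightarrow> real \<Rightarrow>
     (nat \<Rightarrow> path \<Rightarrow> real) \<Rightarrow> (path \<Rightarrow> real) \<Rightarrow> bool" where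
  "LG_approx T E \<P> p \<xi> X \<longleftrightarrow>
     (\<forall>n. \<xi> n \<in> Lip T T) \<and>
     (\<forall>e>0. \<exists>N. \<forall>m\<ge>N. \<forall>n\<ge>N. LG_norm E p (\<lambda>w. \<xi> m w - \<xi> n w) < e) \<and>
     quasi_surely T \<P> (\<lambda>w. (\<lambda>n. \<xi> n w) \<longlonglongrightarrow> X w)"

definition LG :: "real \<Rightarrow> ((path \<Rightarrow> real) \<Rightarrow> real) \<Rightarrow> path measure set \<Rightarrow> real \<Rightarrow> (path \<Rightarrow> real) set" where
  "LG T E \<P> p = {X. \<exists>\<xi>. LG_approx T E \<P> p \<xi> X}"

definition extended_to_LG1 :: "real \<Rightarrow> ((path \<Rightarrow> real) \<Rightarrow> real) \<Rightarrow> path measure set \<Rightarrow> bool" where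
  "extended_to_LG1 T E \<P> \<longleftrightarrow>
     (\<forall>\<xi> X. LG_approx T E \<P> 1 \<xi> X \<longrightarrow> (\<lambda>n. E (\<xi> n)) \<longlonglongrightarrow> E X)"

text \<open>A member of \<open>LG\<close> is Borel measurable only up to a polar set, hence the integrals are taken
  with respect to the completed measures. Integrability and boundedness are stated because the
  integral and the real supremum are total functions in HOL.\<close>

definition represents :: "real \<Rightarrow> ((path \<Rightarrow> real) \<Rightarrow> real) \<Rightarrow> path measure set \<Rightarrow> bool" where
  "represents T E \<P> \<longleftrightarrow> (\<forall>X\<in>LG T E \<P> 1.
     (\<forall>Q\<in>\<P>. integrable (completion Q) X) \<and>
     bdd_above ((\<lambda>Q. LINT w|completion Q. X w) ` \<P>) \<and>
     E X = (SUP Q\<in>\<P>. LINT w|completion Q. X w))"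

text \<open>Processes are compared only at times in \<open>[0,T]\<close> and on paths in \<open>path_space T\<close>.\<close>

definition SG0 :: "real \<Rightarrow> (real \<Rightarrow> path \<Rightarrow> real) set" where
  "SG0 T = {\<eta>. \<exists>ts h. set ts \<subseteq> {0..T} \<and> h \<in> C_bLip (length ts + 1) \<and>
     (\<forall>t\<in>{0..T}. \<forall>w\<in>path_space T. \<eta> t w = h (t # map (\<lambda>s. apply_bcontfun w (min s t)) ts))}"

definition SG_norm :: "real \<Rightarrow> ((path \<Rightarrow> real) \<Rightarrow> real) \<Rightarrow> real \<Rightarrow> (real \<Rightarrow> path \<Rightarrow> real) \<Rightarrow> real" where
  "SG_norm T E p \<eta> = E (\<lambda>w. SUP t\<in>{0..T}. \<bar>\<eta> t w\<bar> powr p) powr (1 / p)"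

definition SG ::
    "real \<Rightarrow> ((path \<Rightarrow> real) \<Rightarrow> real) \<Rightarrow> path measure set \<Rightarrow> real \<Rightarrow> (real \<Rightarrow> path \<Rightarrow> real) set" where
  "SG T E \<P> p = {\<eta>. \<exists>\<zeta>.
     (\<forall>n. \<zeta> n \<in> SG0 T) \<and>
     (\<forall>e>0. \<exists>N. \<forall>m\<ge>N. \<forall>n\<ge>N. SG_norm T E p (\<lambda>t w. \<zeta> m t w - \<zeta> n t w) < e) \<and>
     quasi_surely T \<P> (\<lambda>w. uniform_limit {0..T} (\<lambda>n t. \<zeta> n t w) (\<lambda>t. \<eta> t w) sequentially)}"

end

theory Submission
  imports Defs
begin

text \<open>The map \<open>(a, b) \<mapsto> \<gamma>\<close> with \<open>\<gamma>\<^sub>t = sup\<^sub>s\<^sub>\<le>\<^sub>t (a\<^sub>s \<and> inf\<^sub>s\<^sub>\<le>\<^sub>r\<^sub>\<le>\<^sub>t b\<^sub>r)\<close> is \<open>1\<close>-Lipschitz for the supremum norm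
  on pairs of paths (\<open>sup_min_inf_diff_le\<close>). Hence, if simple processes \<open>a\<^sub>n\<close>, \<open>b\<^sub>n\<close> converge to \<open>\<alpha>\<close>, \<open>\<beta>\<close>,
  the processes \<open>g\<^sub>n = \<gamma>(a\<^sub>n, b\<^sub>n)\<close> converge to \<open>\<gamma>(\<alpha>, \<beta>)\<close> in the same two senses, Cauchy in the norm
  and uniformly in time quasi-surely. The \<open>g\<^sub>n\<close> are not simple, because they look at the whole past of
  the path. Restricting the supremum and the infimum to the stopped grid times \<open>(kT/N) \<and> t\<close> does give
  a simple process (\<open>grid_sup_min_inf_SG0\<close>), as simple processes are stable under maxima, minima and
  stopping; on each path the grid version converges uniformly in \<open>t\<close> to \<open>g\<^sub>n\<close>, as \<open>a\<^sub>n\<close> and \<open>b\<^sub>n\<close> are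
  continuous in time (\<open>grid_sup_min_inf_converges\<close>).

  Convergence on each path must be turned into convergence in the norm. All functionals in play
  are bounded and Lipschitz functions of the path, with a constant that does not depend on \<open>N\<close>. For such
  sequences a Dini argument on the weakly compact set of measures makes the integrals converge
  uniformly in the measure (\<open>weakly_compact_dini\<close>). The expectation is known to be the supremum of the
  integrals only on \<open>L\<^sub>G\<^sup>1\<close>, so the supremum of \<open>\<bar>\<eta>\<^sub>t\<bar>\<^sup>p\<close> for simple \<open>\<eta>\<close> must be shown to lie in that space; it is the value at
  \<open>T\<close> of \<open>\<gamma>\<close> for \<open>\<bar>\<eta>\<bar>\<^sup>p\<close> and a large constant, so the same grid approximation serves
  (\<open>sup_min_inf_in_LG1\<close>, \<open>sup_power_in_LG1\<close>).

  Finally, for each \<open>n\<close> a simple \<open>c\<^sub>n\<close> is chosen with \<open>E\<^sub>Q[sup\<^sub>t \<bar>g\<^sub>n - c\<^sub>n\<bar>\<^sup>p] \<le> 2\<^sup>-\<^sup>n\<close> for all \<open>Q\<close> at once. The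
  bound keeps \<open>c\<^sub>n\<close> Cauchy, and its summability gives \<open>c\<^sub>n - g\<^sub>n \<longlonglongrightarrow> 0\<close> uniformly in time outside one polar
  set (\<open>quasi_surely_tendsto_zero\<close>).\<close>

section \<open>The sup-min-inf functional\<close>

text \<open>The index sets on the two sides may differ, even in type. Matching every \<open>i\<close> with an \<open>i'\<close>, and
  the constraints of \<open>i'\<close> with those of \<open>i\<close>, is what both uses need: equal index sets give the
  Lipschitz property, and an interval against a grid gives the discretisation error.\<close>

lemma sup_min_inf_le:
  fixes e :: real
  assumes "I \<noteq> {}" and "bdd_above (a' ` I')"
    and "\<And>i. i \<in> I \<Longrightarrow> bdd_below (b ` R i)"
    and "\<And>i. i \<in> I' \<Longrightarrow> R' i \<noteq> {}"
    and match: "\<And>i. i \<in> I \<Longrightarrow>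
      \<exists>i'\<in>I'. a i \<le> a' i' + e \<and> (\<forall>j'\<in>R' i'. \<exists>j\<in>R i. b j \<le> b' j' + e)"
  shows "(SUP i\<in>I. min (a i) (INF j\<in>R i. b j)) \<le> (SUP i\<in>I'. min (a' i) (INF j\<in>R' i. b' j)) + e"
proof (rule cSUP_least[OF \<open>I \<noteq> {}\<close>])
  fix i assume i: "i \<in> I"
  obtain i' where i': "i' \<in> I'" "a i \<le> a' i' + e" "\<forall>j'\<in>R' i'. \<exists>j\<in>R i. b j \<le> b' j' + e"
    using match[OF i] by blast
  have "(INF j\<in>R i. b j) - e \<le> (INF j\<in>R' i'. b' j)"
  proof (rule cINF_greatest)
    show "R' i' \<noteq> {}" using assms(4) i' by blast
    fix j' assume "j' \<in> R' i'"
    then obtain j where "j \<in> R i" "b j \<le> b' j' + e" using i' by blast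
    moreover have "(INF j\<in>R i. b j) \<le> b j"
      using assms(3)[OF i] \<open>j \<in> R i\<close> by (rule cINF_lower)
    ultimately show "(INF j\<in>R i. b j) - e \<le> b' j'" by linarith
  qed
  then have "min (a i) (INF j\<in>R i. b j) \<le> min (a' i') (INF j\<in>R' i'. b' j) + e"
    using i' by linarith
  also have "min (a' i') (INF j\<in>R' i'. b' j) \<le> (SUP i\<in>I'. min (a' i) (INF j\<in>R' i. b' j))"
  proof (rule cSUP_upper[OF \<open>i' \<in> I'\<close>])
    obtain M where "\<And>i. i \<in> I' \<Longrightarrow> a' i \<le> M" using assms(2) by (auto simp: bdd_above_def)
    then show "bdd_above ((\<lambda>i. min (a' i) (INF j\<in>R' i. b' j)) ` I')"
      by (intro bdd_aboveI2[where M = M]) (auto intro: min.coboundedI1)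
  qed
  finally show "min (a i) (INF j\<in>R i. b j) \<le> (SUP i\<in>I'. min (a' i) (INF j\<in>R' i. b' j)) + e"
    by simp
qed

definition sup_min_inf :: "(real \<Rightarrow> path \<Rightarrow> real) \<Rightarrow> (real \<Rightarrow> path \<Rightarrow> real) \<Rightarrow> real \<Rightarrow> path \<Rightarrow> real" where
  "sup_min_inf a b t w = (SUP s\<in>{0..t}. min (a s w) (INF r\<in>{s..t}. b r w))"

text \<open>The grid is stopped at \<open>t\<close> instead of being cut off there: every index \<open>k\<close> contributes at every
  time, which keeps the process continuous in \<open>t\<close> and expressible through stopped processes. For \<open>N = 0\<close>
  division by zero yields the single grid point \<open>0\<close>.\<close>

definition grid_sup_min_inf ::
    "real \<Rightarrow> nat \<Rightarrow> (real \<Rightarrow> path \<Rightarrow> real) \<Rightarrow> (real \<Rightarrow> path \<Rightarrow> real) \<Rightarrow> real \<Rightarrow> path \<Rightarrow> real" where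
  "grid_sup_min_inf T N a b t w =
     (SUP k\<in>{..N}. min (a (min (real k * T / real N) t) w)
                        (INF j\<in>{k..N}. b (min (real j * T / real N) t) w))"

lemma sup_min_inf_diff_le:
  assumes "t \<in> {0..T}"
    and "\<And>s. s \<in> {0..T} \<Longrightarrow> \<bar>a s w\<bar> \<le> M" "\<And>s. s \<in> {0..T} \<Longrightarrow> \<bar>b s w\<bar> \<le> M"
    and "\<And>s. s \<in> {0..T} \<Longrightarrow> \<bar>a' s w\<bar> \<le> M" "\<And>s. s \<in> {0..T} \<Longrightarrow> \<bar>b' s w\<bar> \<le> M"
    and "\<And>s. s \<in> {0..T} \<Longrightarrow> \<bar>a s w - a' s w\<bar> \<le> e" "\<And>s. s \<in> {0..T} \<Longrightarrow> \<bar>b s w - b' s w\<bar> \<le> e"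
  shows "\<bar>sup_min_inf a b t w - sup_min_inf a' b' t w\<bar> \<le> e"
proof -
  have one: "sup_min_inf a b t w \<le> sup_min_inf a' b' t w + e"
    if bd: "\<And>s. s \<in> {0..T} \<Longrightarrow> \<bar>a' s w\<bar> \<le> M" "\<And>s. s \<in> {0..T} \<Longrightarrow> \<bar>b s w\<bar> \<le> M"
      and cl: "\<And>s. s \<in> {0..T} \<Longrightarrow> \<bar>a s w - a' s w\<bar> \<le> e" "\<And>s. s \<in> {0..T} \<Longrightarrow> \<bar>b s w - b' s w\<bar> \<le> e"
    for a b a' b'
    unfolding sup_min_inf_def
  proof (rule sup_min_inf_le)
    show "bdd_above ((\<lambda>s. a' s w) ` {0..t})"
      using bd(1) \<open>t \<in> {0..T}\<close> by (intro bdd_aboveI2[where M = M]) (force simp: abs_le_iff)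
    fix i assume i: "i \<in> {0..t}"
    have "- M \<le> b r w" if "r \<in> {i..t}" for r
      using bd(2)[of r] that i assms(1) by (simp add: abs_le_iff)
    then show "bdd_below ((\<lambda>r. b r w) ` {i..t})" by (rule bdd_belowI2)
    show "\<exists>i'\<in>{0..t}. a i w \<le> a' i' w + e \<and> (\<forall>j'\<in>{i'..t}. \<exists>j\<in>{i..t}. b j w \<le> b' j' w + e)"
    proof (rule bexI[of _ i], intro conjI ballI)
      show "a i w \<le> a' i w + e" using cl(1)[of i] i assms(1) by auto
      fix j assume j: "j \<in> {i..t}"
      then show "\<exists>k\<in>{i..t}. b k w \<le> b' j w + e"
        using cl(2)[of j] i assms(1) by (intro bexI[of _ j]) auto
    qed fact
  qed (use assms(1) in auto)
  have "\<And>s. s \<in> {0..T} \<Longrightarrow> \<bar>a' s w - a s w\<bar> \<le> e" "\<And>s. s \<in> {0..T} \<Longrightarrow> \<bar>b' s w - b s w\<bar> \<le> e"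
    using assms(6,7) by (simp_all add: abs_minus_commute)
  with one[of a' b a b'] one[of a b' a' b] assms show ?thesis by (simp add: abs_le_iff)
qed

text \<open>Rounding up, not down, is essential below: the grid point replacing \<open>s\<close> in the supremum must not
  lie before \<open>s\<close>, or the infimum over later times would acquire constraints that were not there.\<close>

lemma next_grid_point:
  fixes T r :: real and N :: nat
  assumes "T > 0" "N > 0" "r \<in> {0..T}"
  obtains d where "d \<le> N" "r \<le> real d * T / real N" "real d * T / real N \<le> r + T / real N"
proof -
  define x where "x = r * real N / T"
  have x: "0 \<le> x" "x \<le> real N" using assms by (auto simp: x_def field_simps)
  define d where "d = nat \<lceil>x\<rceil>"
  have d: "x \<le> real d" "real d \<le> x + 1" "d \<le> N"
    using x unfolding d_def by linarith+
  have "r = x * T / real N" using assms by (simp add: x_def)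
  moreover have "x * T / real N \<le> real d * T / real N" "real d * T / real N \<le> (x + 1) * T / real N"
    using d assms by (auto intro!: divide_right_mono mult_right_mono)
  moreover have "(x + 1) * T / real N = x * T / real N + T / real N"
    by (simp add: distrib_right add_divide_distrib)
  ultimately show thesis using d(3) that by simp
qed

text \<open>Uniform continuity of the two paths on \<open>[0,T]\<close> gives a modulus that works for all \<open>t\<close>. A time \<open>s\<close> is
  matched with the next grid point, and a grid point with itself; on the side of the infimum, a time
  \<open>r\<close> after a grid point \<open>k\<close> is matched with the next grid point that is also not before \<open>k\<close>.\<close>

lemma grid_sup_min_inf_converges:
  fixes a b :: "real \<Rightarrow> path \<Rightarrow> real"
  assumes "T > 0" "e > 0"
    and cont: "continuous_on {0..T} (\<lambda>s. a s w)" "continuous_on {0..T} (\<lambda>s. b s w)"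
  shows "\<exists>N0. \<forall>N\<ge>N0. \<forall>t\<in>{0..T}. \<bar>sup_min_inf a b t w - grid_sup_min_inf T N a b t w\<bar> \<le> e"
proof -
  have "uniformly_continuous_on {0..T} (\<lambda>s. a s w)" "uniformly_continuous_on {0..T} (\<lambda>s. b s w)"
    using cont by (auto intro: compact_uniformly_continuous)
  then obtain d1 d2 where d: "d1 > 0" "d2 > 0"
    and d1: "\<And>s r. s \<in> {0..T} \<Longrightarrow> r \<in> {0..T} \<Longrightarrow> dist r s < d1 \<Longrightarrow> dist (a r w) (a s w) < e"
    and d2: "\<And>s r. s \<in> {0..T} \<Longrightarrow> r \<in> {0..T} \<Longrightarrow> dist r s < d2 \<Longrightarrow> dist (b r w) (b s w) < e"
    unfolding uniformly_continuous_on_def using \<open>e > 0\<close> by metis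
  obtain N0 :: nat where N0: "N0 > 0" "T / real N0 < min d1 d2"
  proof -
    obtain n :: nat where "T / min d1 d2 < real n" using reals_Archimedean2 by blast
    moreover have "0 < T / min d1 d2" using d assms by simp
    ultimately have "0 < real n" by linarith
    with \<open>T / min d1 d2 < real n\<close> have "n > 0" "T / real n < min d1 d2"
      using d by (auto simp: divide_less_eq mult.commute simp del: min_less_iff_conj)
    then show thesis using that by blast
  qed
  have close: "\<bar>sup_min_inf a b t w - grid_sup_min_inf T N a b t w\<bar> \<le> e"
    if "N \<ge> N0" and t: "t \<in> {0..T}" for N t
  proof -
    have N: "N > 0" using that N0 by simp
    have "T / real N \<le> T / real N0" using that N0 \<open>T > 0\<close> by (simp add: frac_le)
    then have mesh: "T / real N < d1" "T / real N < d2" using N0 by auto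
    define u where "u k = min (real k * T / real N) t" for k :: nat
    have u: "u k \<in> {0..t}" for k using t \<open>T > 0\<close> by (auto simp: u_def)
    then have uT: "u k \<in> {0..T}" for k using t by (meson atLeastAtMost_iff order_trans)
    have u_mono: "u k \<le> u j" if "k \<le> j" for k j
      unfolding u_def using that \<open>T > 0\<close>
      by (intro min.mono divide_right_mono mult_right_mono) auto
    have "bdd_above ((\<lambda>s. a s w) ` {0..T})" "bdd_below ((\<lambda>s. b s w) ` {0..T})"
      using cont compact_continuous_image compact_Icc bounded_imp_bdd_above bounded_imp_bdd_below
        compact_imp_bounded by metis+
    then have bdd: "bdd_above ((\<lambda>s. a s w) ` {0..t})" "\<And>s. s \<ge> 0 \<Longrightarrow> bdd_below ((\<lambda>s. b s w) ` {s..t})"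
      using t by (auto elim!: bdd_above_mono bdd_below_mono)
    have "sup_min_inf a b t w \<le> grid_sup_min_inf T N a b t w + e"
      unfolding sup_min_inf_def grid_sup_min_inf_def u_def[symmetric]
    proof (rule sup_min_inf_le)
      fix s assume s: "s \<in> {0..t}"
      obtain k where k: "k \<le> N" "s \<le> real k * T / real N" "real k * T / real N \<le> s + T / real N"
        using next_grid_point[OF \<open>T > 0\<close> N, of s] s t by auto
      have sk: "s \<le> u k" "u k \<le> s + T / real N" using k s by (auto simp: u_def)
      have "dist (u k) s < d1" using sk mesh by (auto simp: dist_real_def)
      then have "dist (a (u k) w) (a s w) < e" using d1 uT s t by auto
      then have "a s w \<le> a (u k) w + e" by (auto simp: dist_real_def)
      moreover have "\<exists>r\<in>{s..t}. b r w \<le> b (u j) w + e" if "j \<in> {k..N}" for j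
        using that sk u_mono[of k j] u[of j] \<open>e > 0\<close> by (intro bexI[of _ "u j"]) auto
      ultimately show "\<exists>k\<in>{..N}. a s w \<le> a (u k) w + e \<and>
          (\<forall>j\<in>{k..N}. \<exists>r\<in>{s..t}. b r w \<le> b (u j) w + e)"
        using k by (intro bexI[of _ k]) auto
    qed (use t bdd in auto)
    moreover have "grid_sup_min_inf T N a b t w \<le> sup_min_inf a b t w + e"
      unfolding sup_min_inf_def grid_sup_min_inf_def u_def[symmetric]
    proof (rule sup_min_inf_le)
      fix k assume k: "k \<in> {..N}"
      have "\<exists>j\<in>{k..N}. b (u j) w \<le> b r w + e" if r: "r \<in> {u k..t}" for r
      proof -
        have rT: "r \<in> {0..T}" using r u[of k] t by auto
        obtain d where dd: "d \<le> N" "r \<le> real d * T / real N" "real d * T / real N \<le> r + T / real N"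
          using next_grid_point[OF \<open>T > 0\<close> N rT] by auto
        \<comment> \<open>For \<open>k \<ge> d\<close> the \<open>k\<close>-th grid point is not before \<open>r\<close> either, which forces \<open>u k = r\<close>.\<close>
        define j where "j = max k d"
        have "r \<le> u d" "u d \<le> r + T / real N" using dd r by (auto simp: u_def)
        then have "r \<le> u j" "u j \<le> r + T / real N"
          using u_mono[of d j] r \<open>T > 0\<close> by (auto simp: j_def max_def intro: order_trans)
        then have "dist (u j) r < d2" using mesh by (auto simp: dist_real_def)
        then have "dist (b (u j) w) (b r w) < e" using d2 uT rT by auto
        then have "b (u j) w \<le> b r w + e" by (auto simp: dist_real_def)
        then show ?thesis using k dd by (intro bexI[of _ j]) (auto simp: j_def)
      qed
      then show "\<exists>s\<in>{0..t}. a (u k) w \<le> a s w + e \<and>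
          (\<forall>r\<in>{s..t}. \<exists>j\<in>{k..N}. b (u j) w \<le> b r w + e)"
        using u \<open>e > 0\<close> by (intro bexI[of _ "u k"]) auto
    qed (use t bdd in auto)
    ultimately show ?thesis by (simp add: abs_le_iff)
  qed
  then show ?thesis by blast
qed

section \<open>Bounded Lipschitz functions of the path\<close>

text \<open>A single constant serves as bound and as Lipschitz constant, so that one number controls a whole
  family of functionals uniformly.\<close>

definition bounded_lipschitz :: "real \<Rightarrow> real \<Rightarrow> (path \<Rightarrow> real) \<Rightarrow> bool" where
  "bounded_lipschitz T K F \<longleftrightarrow>
     K-lipschitz_on (path_space T) F \<and> (\<forall>w\<in>path_space T. \<bar>F w\<bar> \<le> K)"

lemma zero_path: "0 \<in> path_space T"
  by (simp add: path_space_def zero_bcontfun.rep_eq)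

lemma bounded_lipschitzI:
  assumes bd: "\<And>w. w \<in> path_space T \<Longrightarrow> \<bar>F w\<bar> \<le> K"
    and lip: "\<And>w w'. w \<in> path_space T \<Longrightarrow> w' \<in> path_space T \<Longrightarrow> F w \<le> F w' + K * dist w w'"
  shows "bounded_lipschitz T K F"
proof -
  have "0 \<le> K" using bd[OF zero_path] by linarith
  moreover have "dist (F w) (F w') \<le> K * dist w w'" if "w \<in> path_space T" "w' \<in> path_space T" for w w'
    using lip[OF that] lip[OF that(2,1)] by (simp add: dist_real_def dist_commute abs_le_iff)
  ultimately show ?thesis using bd by (auto simp: bounded_lipschitz_def lipschitz_on_def)
qed

lemma bounded_lipschitz_bound: "bounded_lipschitz T K F \<Longrightarrow> w \<in> path_space T \<Longrightarrow> \<bar>F w\<bar> \<le> K"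
  by (simp add: bounded_lipschitz_def)

lemma bounded_lipschitz_abs_diff:
  assumes "bounded_lipschitz T K F" "w \<in> path_space T" "w' \<in> path_space T"
  shows "\<bar>F w - F w'\<bar> \<le> K * dist w w'"
  using assms by (auto simp: bounded_lipschitz_def lipschitz_on_def dist_real_def)

lemma bounded_lipschitz_nonneg: "bounded_lipschitz T K F \<Longrightarrow> 0 \<le> K"
  by (auto simp: bounded_lipschitz_def lipschitz_on_def)

lemma bounded_lipschitz_mono:
  assumes "bounded_lipschitz T K F" "K \<le> K'"
  shows "bounded_lipschitz T K' F"
  using assms lipschitz_on_le by (fastforce simp: bounded_lipschitz_def)

text \<open>The constant does not deteriorate, whatever the number of indices; hence the grid
  functionals have a common constant for all \<open>N\<close>.\<close>

lemma bounded_lipschitz_sup_min_inf: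
  assumes "I \<noteq> {}" "\<And>i. i \<in> I \<Longrightarrow> R i \<noteq> {}"
    and a: "\<And>i. i \<in> I \<Longrightarrow> bounded_lipschitz T K (a i)"
    and b: "\<And>i j. i \<in> I \<Longrightarrow> j \<in> R i \<Longrightarrow> bounded_lipschitz T K (b j)"
  shows "bounded_lipschitz T K (\<lambda>w. SUP i\<in>I. min (a i w) (INF j\<in>R i. b j w))"
proof (rule bounded_lipschitzI)
  fix w assume w: "w \<in> path_space T"
  have aw: "\<bar>a i w\<bar> \<le> K" if "i \<in> I" for i using a[OF that] w by (rule bounded_lipschitz_bound)
  have bw: "\<bar>b j w\<bar> \<le> K" if "i \<in> I" "j \<in> R i" for i j
    using b[OF that] w by (rule bounded_lipschitz_bound)
  have bdda: "bdd_above ((\<lambda>i. a i w) ` I)"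
    using aw by (intro bdd_aboveI2[where M = K]) (auto simp: abs_le_iff)
  have lower: "- K \<le> min (a i w) (INF j\<in>R i. b j w)" if "i \<in> I" for i
  proof -
    have "- K \<le> (INF j\<in>R i. b j w)"
      using assms(2)[OF that] bw[OF that]
      by (intro cINF_greatest) (auto simp: abs_le_iff minus_le_iff)
    then show ?thesis using aw[OF that] by (auto simp: abs_le_iff)
  qed
  have upper: "min (a i w) (INF j\<in>R i. b j w) \<le> K" if "i \<in> I" for i
    using aw[OF that] by auto
  obtain i where i: "i \<in> I" using \<open>I \<noteq> {}\<close> by blast
  have "- K \<le> (SUP i\<in>I. min (a i w) (INF j\<in>R i. b j w))"
    using upper by (intro cSUP_upper2[where x = i] bdd_aboveI2 i lower)
  moreover have "(SUP i\<in>I. min (a i w) (INF j\<in>R i. b j w)) \<le> K"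
    using upper by (intro cSUP_least \<open>I \<noteq> {}\<close>)
  ultimately show "\<bar>SUP i\<in>I. min (a i w) (INF j\<in>R i. b j w)\<bar> \<le> K" by linarith
next
  fix w w' assume w: "w \<in> path_space T" "w' \<in> path_space T"
  show "(SUP i\<in>I. min (a i w) (INF j\<in>R i. b j w))
      \<le> (SUP i\<in>I. min (a i w') (INF j\<in>R i. b j w')) + K * dist w w'"
  proof (rule sup_min_inf_le)
    have "a i w' \<le> K" if "i \<in> I" for i
      using bounded_lipschitz_bound[OF a[OF that] w(2)] by (simp add: abs_le_iff)
    then show "bdd_above ((\<lambda>i. a i w') ` I)" by (rule bdd_aboveI2)
    fix i assume i: "i \<in> I"
    have "- K \<le> b j w" if "j \<in> R i" for j
      using bounded_lipschitz_bound[OF b[OF i that] w(1)] by (simp add: abs_le_iff)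
    then show "bdd_below ((\<lambda>j. b j w) ` R i)" by (rule bdd_belowI2)
    show "\<exists>i'\<in>I. a i w \<le> a i' w' + K * dist w w' \<and>
        (\<forall>j'\<in>R i'. \<exists>j\<in>R i. b j w \<le> b j' w' + K * dist w w')"
    proof (intro bexI[of _ i] conjI ballI)
      show "a i w \<le> a i w' + K * dist w w'"
        using bounded_lipschitz_abs_diff[OF a[OF i] w] by linarith
      fix j assume "j \<in> R i"
      then show "\<exists>k\<in>R i. b k w \<le> b j w' + K * dist w w'"
        using bounded_lipschitz_abs_diff[OF b[OF i \<open>j \<in> R i\<close>] w] by (intro bexI[of _ j]) linarith
    qed (rule i)
  qed (use assms in auto)
qed

lemma bounded_lipschitz_SUP:
  assumes "I \<noteq> {}" "\<And>i. i \<in> I \<Longrightarrow> bounded_lipschitz T K (f i)"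
  shows "bounded_lipschitz T K (\<lambda>w. SUP i\<in>I. f i w)"
  using bounded_lipschitz_sup_min_inf[where a = f and b = f and R = "\<lambda>i. {i}" and I = I] assms
  by simp

lemma bounded_lipschitz_diff:
  assumes "bounded_lipschitz T K F" "bounded_lipschitz T K G"
  shows "bounded_lipschitz T (2 * K) (\<lambda>w. F w - G w)"
proof (rule bounded_lipschitzI)
  fix w w' assume w: "w \<in> path_space T"
  show "\<bar>F w - G w\<bar> \<le> 2 * K"
    using bounded_lipschitz_bound[OF assms(1) w] bounded_lipschitz_bound[OF assms(2) w] by linarith
  assume w': "w' \<in> path_space T"
  show "F w - G w \<le> F w' - G w' + 2 * K * dist w w'"
    using bounded_lipschitz_abs_diff[OF assms(1) w w'] bounded_lipschitz_abs_diff[OF assms(2) w w']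
    by linarith
qed

lemma abs_powr_lipschitz:
  fixes p M x y :: real
  assumes "p \<ge> 1" "\<bar>x\<bar> \<le> M" "\<bar>y\<bar> \<le> M"
  shows "\<bar>\<bar>x\<bar> powr p - \<bar>y\<bar> powr p\<bar> \<le> p * M powr (p - 1) * \<bar>x - y\<bar>"
proof -
  have le: "v powr p - u powr p \<le> p * M powr (p - 1) * (v - u)" if uv: "0 \<le> u" "u < v" "v \<le> M" for u v
  proof -
    have "continuous_on {u..v} (\<lambda>z. z powr p)"
      using uv assms(1) by (intro continuous_on_powr' continuous_intros) auto
    moreover have "((\<lambda>z. z powr p) has_real_derivative p * z powr (p - 1)) (at z)"
      if "u < z" "z < v" for z
      using that uv by (intro has_real_derivative_powr) auto
    ultimately obtain l z where z: "u < z" "z < v" "((\<lambda>z. z powr p) has_real_derivative l) (at z)"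
        "v powr p - u powr p = (v - u) * l"
      using MVT[of u v "\<lambda>z. z powr p"] uv real_differentiable_def by blast
    have "l = p * z powr (p - 1)"
      using z uv has_real_derivative_powr[of z p] by (auto dest: DERIV_unique)
    then have "l \<le> p * M powr (p - 1)"
      using z uv assms(1) by (auto intro!: mult_left_mono powr_mono2)
    then show ?thesis using z uv by (simp add: mult.commute mult_left_mono)
  qed
  have sym: "\<bar>v powr p - u powr p\<bar> \<le> p * M powr (p - 1) * (v - u)" if "0 \<le> u" "u \<le> v" "v \<le> M" for u v
  proof (cases "u = v")
    case False
    then show ?thesis using le[of u v] powr_mono2[of p u v] that assms(1) by auto
  qed simp
  have "\<bar>\<bar>x\<bar> powr p - \<bar>y\<bar> powr p\<bar> \<le> p * M powr (p - 1) * \<bar>\<bar>x\<bar> - \<bar>y\<bar>\<bar>"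
    using sym[of "\<bar>x\<bar>" "\<bar>y\<bar>"] sym[of "\<bar>y\<bar>" "\<bar>x\<bar>"] assms
    by (cases "\<bar>x\<bar> \<le> \<bar>y\<bar>") (auto simp: abs_minus_commute)
  also have "\<dots> \<le> p * M powr (p - 1) * \<bar>x - y\<bar>"
    using assms(1) by (intro mult_left_mono) auto
  finally show ?thesis .
qed

lemma bounded_lipschitz_abs_powr:
  assumes "bounded_lipschitz T K F" "p \<ge> 1"
  shows "bounded_lipschitz T (max (K powr p) (p * K powr (p - 1) * K)) (\<lambda>w. \<bar>F w\<bar> powr p)"
proof (rule bounded_lipschitzI)
  fix w w' assume w: "w \<in> path_space T"
  show "\<bar>\<bar>F w\<bar> powr p\<bar> \<le> max (K powr p) (p * K powr (p - 1) * K)"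
    using bounded_lipschitz_bound[OF assms(1) w] assms(2) by (simp add: le_max_iff_disj powr_mono2)
  assume w': "w' \<in> path_space T"
  have "\<bar>F w\<bar> powr p - \<bar>F w'\<bar> powr p \<le> p * K powr (p - 1) * \<bar>F w - F w'\<bar>"
    using abs_powr_lipschitz[OF assms(2) bounded_lipschitz_bound[OF assms(1) w]
        bounded_lipschitz_bound[OF assms(1) w']] by linarith
  also have "\<dots> \<le> p * K powr (p - 1) * (K * dist w w')"
    using bounded_lipschitz_abs_diff[OF assms(1) w w'] assms(2) by (intro mult_left_mono) auto
  also have "\<dots> = (p * K powr (p - 1) * K) * dist w w'" by simp
  also have "\<dots> \<le> max (K powr p) (p * K powr (p - 1) * K) * dist w w'"
    by (intro mult_right_mono) auto
  finally show "\<bar>F w\<bar> powr p \<le> \<bar>F w'\<bar> powr p + max (K powr p) (p * K powr (p - 1) * K) * dist w w'"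
    by linarith
qed

section \<open>Uniform smallness over a weakly compact set of measures\<close>

lemma path_probs_space: "Q \<in> path_probs T \<Longrightarrow> space Q = path_space T"
  using sets_eq_imp_space_eq[of Q "path_borel T"]
  by (auto simp: path_probs_def path_borel_def space_restrict_space)

lemma bounded_lipschitz_measurable:
  assumes "bounded_lipschitz T K F" "Q \<in> path_probs T"
  shows "F \<in> borel_measurable Q"
proof -
  have "continuous_on (path_space T) F"
    using assms(1) lipschitz_on_continuous_on by (auto simp: bounded_lipschitz_def)
  then have "F \<in> borel_measurable (path_borel T)"
    unfolding path_borel_def by (rule borel_measurable_continuous_on_restrict)
  moreover have "sets Q = sets (path_borel T)" using assms(2) by (simp add: path_probs_def)
  ultimately show ?thesis using measurable_cong_sets by blast
qed

lemma bounded_lipschitz_integrable: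
  assumes "bounded_lipschitz T K F" "Q \<in> path_probs T"
  shows "integrable Q F"
proof -
  interpret prob_space Q using assms(2) by (simp add: path_probs_def)
  show ?thesis
    using bounded_lipschitz_measurable[OF assms] bounded_lipschitz_bound[OF assms(1)]
    by (intro integrable_const_bound[where B = K]) (auto simp: path_probs_space[OF assms(2)])
qed

lemma topspace_weak_topology: "topspace (weak_topology T) \<subseteq> path_probs T"
  unfolding weak_topology_def topology_generated_by_topspace by blast

text \<open>The tail suprema \<open>V\<^sub>N = sup\<^sub>n\<^sub>\<ge>\<^sub>N F\<^sub>n\<close> inherit the common constant, hence are continuous, and they decrease
  to \<open>0\<close>. The sets of measures with \<open>E\<^sub>Q[V\<^sub>N] < e\<close> are therefore weakly open, increase with \<open>N\<close>, and cover
  by dominated convergence; compactness leaves one \<open>N\<close>. Without the common Lipschitz constant the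
  tail suprema would be only lower semicontinuous, and the sets need not be open.\<close>

lemma weakly_compact_dini:
  assumes comp: "compactin (weak_topology T) \<P>" and "e > 0"
    and BL: "\<And>n. bounded_lipschitz T K (F n)"
    and nonneg: "\<And>n w. w \<in> path_space T \<Longrightarrow> 0 \<le> F n w"
    and lim: "\<And>w. w \<in> path_space T \<Longrightarrow> (\<lambda>n. F n w) \<longlonglongrightarrow> 0"
  shows "\<exists>N. \<forall>n\<ge>N. \<forall>Q\<in>\<P>. (LINT w|Q. F n w) \<le> e"
proof -
  have PP: "\<P> \<subseteq> path_probs T"
    using compactin_subset_topspace[OF comp] topspace_weak_topology by blast
  define V where "V N w = (SUP n\<in>{N..}. F n w)" for N w
  have V_BL: "bounded_lipschitz T K (V N)" for N
    unfolding V_def by (intro bounded_lipschitz_SUP BL) auto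
  have bdd: "bdd_above ((\<lambda>n. F n w) ` {N..})" if "w \<in> path_space T" for w N
    using bounded_lipschitz_bound[OF BL that]
    by (intro bdd_aboveI2[where M = K]) (auto simp: abs_le_iff)
  have F_le_V: "F n w \<le> V N w" if "w \<in> path_space T" "N \<le> n" for w n N
    unfolding V_def using that bdd by (intro cSUP_upper) auto
  have V_lim: "(\<lambda>n. V n w) \<longlonglongrightarrow> 0" if w: "w \<in> path_space T" for w
  proof (rule LIMSEQ_I)
    fix r :: real assume "r > 0"
    then obtain N where N: "\<And>n. n \<ge> N \<Longrightarrow> norm (F n w - 0) < r / 2"
      using LIMSEQ_D[OF lim[OF w], of "r / 2"] by auto
    have "norm (V n w - 0) < r" if "n \<ge> N" for n
    proof -
      have "V n w \<le> r / 2" unfolding V_def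
      proof (rule cSUP_least)
        fix k assume "k \<in> {n..}"
        then show "F k w \<le> r / 2" using N[of k] that by auto
      qed simp
      moreover have "0 \<le> V n w" using F_le_V[OF w order_refl, of n] nonneg[OF w, of n] by linarith
      ultimately show ?thesis using \<open>r > 0\<close> by simp
    qed
    then show "\<exists>N. \<forall>n\<ge>N. norm (V n w - 0) < r" by blast
  qed
  define U where "U N = {Q \<in> path_probs T. (LINT w|Q. V N w) \<in> {..<e}}" for N
  have U_open: "openin (weak_topology T) (U N)" for N
  proof -
    have "continuous_on (path_space T) (V N)"
      using V_BL[of N] lipschitz_on_continuous_on by (auto simp: bounded_lipschitz_def)
    moreover have "bounded (V N ` path_space T)"
      using bounded_lipschitz_bound[OF V_BL[of N]] by (auto simp: bounded_iff)
    ultimately show ?thesis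
      unfolding weak_topology_def U_def
      by (intro topology_generated_by_Basis CollectI exI[of _ "V N"] exI[of _ "{..<e}"]) auto
  qed
  have cover: "\<P> \<subseteq> \<Union> (range U)"
  proof
    fix Q assume "Q \<in> \<P>"
    then have Q: "Q \<in> path_probs T" using PP by blast
    interpret prob_space Q using Q by (simp add: path_probs_def)
    have "(\<lambda>n. LINT w|Q. V n w) \<longlonglongrightarrow> (LINT w|Q. 0)"
      using V_lim bounded_lipschitz_measurable[OF V_BL Q] bounded_lipschitz_bound[OF V_BL]
      by (intro integral_dominated_convergence[where w = "\<lambda>_. K"])
         (auto simp: path_probs_space[OF Q])
    then have "eventually (\<lambda>n. (LINT w|Q. V n w) < e) sequentially"
      using \<open>e > 0\<close> by (auto intro: order_tendstoD)
    then obtain N where "(LINT w|Q. V N w) < e" by (auto simp: eventually_sequentially)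
    then show "Q \<in> \<Union> (range U)" using Q by (auto simp: U_def)
  qed
  obtain \<F> where F: "finite \<F>" "\<F> \<subseteq> range U" "\<P> \<subseteq> \<Union> \<F>"
    using comp cover U_open unfolding compactin_def by (metis (no_types, lifting) rangeE)
  obtain J where J: "finite J" "\<F> = U ` J" using F finite_subset_image by metis
  obtain N where N: "\<And>j. j \<in> J \<Longrightarrow> j \<le> N" using J(1) by (auto simp: finite_nat_set_iff_bounded_le)
  have "(LINT w|Q. F n w) \<le> e" if "n \<ge> N" "Q \<in> \<P>" for n Q
  proof -
    have Q: "Q \<in> path_probs T" using that PP by blast
    obtain j where j: "j \<in> J" "Q \<in> U j" using F(3) J(2) \<open>Q \<in> \<P>\<close> by blast
    have "(LINT w|Q. F n w) \<le> (LINT w|Q. V j w)"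
      using F_le_V N[OF j(1)] that
      by (intro integral_mono bounded_lipschitz_integrable[OF _ Q, of K] BL V_BL)
         (auto simp: path_probs_space[OF Q])
    also have "\<dots> \<le> e" using j by (auto simp: U_def)
    finally show ?thesis .
  qed
  then show ?thesis by blast
qed

section \<open>Calculus of the simple processes\<close>

lemma coordinate_le_eucl_dist:
  assumes "i < length x"
  shows "\<bar>x ! i - y ! i\<bar> \<le> eucl_dist x y"
  using member_le_L2_set[of "{..<length x}" i "\<lambda>i. \<bar>x ! i - y ! i\<bar>"] assms
  by (simp add: eucl_dist_def L2_set_def)

lemma eucl_dist_le_sum: "eucl_dist x y \<le> (\<Sum>i<length x. \<bar>x ! i - y ! i\<bar>)"
  unfolding eucl_dist_def by (rule L2_set_le_sum_abs)

lemma eucl_dist_le: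
  assumes "\<And>i. i < length x \<Longrightarrow> \<bar>x ! i - y ! i\<bar> \<le> D"
  shows "eucl_dist x y \<le> real (length x) * D"
proof -
  have "(\<Sum>i<length x. \<bar>x ! i - y ! i\<bar>) \<le> (\<Sum>i<length x. D)"
    using assms by (intro sum_mono) auto
  then show ?thesis using eucl_dist_le_sum[of x y] by simp
qed

lemma eucl_dist_nonneg: "0 \<le> eucl_dist x y"
  by (simp add: eucl_dist_def L2_set_nonneg)

text \<open>Names the witnesses hidden in membership of \<open>SG0\<close>. Requiring \<open>L \<ge> 0\<close> loses nothing and lets
  estimates of distances be multiplied by \<open>L\<close>.\<close>

definition simple_rep ::
    "real \<Rightarrow> real list \<Rightarrow> (real list \<Rightarrow> real) \<Rightarrow> real \<Rightarrow> real \<Rightarrow> (real \<Rightarrow> path \<Rightarrow> real) \<Rightarrow> bool" where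
  "simple_rep T ts h M L \<eta> \<longleftrightarrow> set ts \<subseteq> {0..T} \<and> 0 \<le> L \<and>
     (\<forall>x. length x = length ts + 1 \<longrightarrow> \<bar>h x\<bar> \<le> M) \<and>
     (\<forall>x y. length x = length ts + 1 \<longrightarrow> length y = length ts + 1 \<longrightarrow>
        \<bar>h x - h y\<bar> \<le> L * eucl_dist x y) \<and>
     (\<forall>t\<in>{0..T}. \<forall>w\<in>path_space T. \<eta> t w = h (t # map (\<lambda>s. apply_bcontfun w (min s t)) ts))"

lemma simple_repD:
  assumes "simple_rep T ts h M L \<eta>"
  shows "set ts \<subseteq> {0..T}" "0 \<le> L"
    "\<And>x. length x = length ts + 1 \<Longrightarrow> \<bar>h x\<bar> \<le> M"
    "\<And>x y. length x = length ts + 1 \<Longrightarrow> length y = length ts + 1 \<Longrightarrow>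
      \<bar>h x - h y\<bar> \<le> L * eucl_dist x y"
    "\<And>t w. t \<in> {0..T} \<Longrightarrow> w \<in> path_space T \<Longrightarrow>
      \<eta> t w = h (t # map (\<lambda>s. apply_bcontfun w (min s t)) ts)"
  using assms by (auto simp: simple_rep_def)

lemma SG0E:
  assumes "\<eta> \<in> SG0 T"
  obtains ts h M L where "simple_rep T ts h M L \<eta>"
proof -
  obtain ts h M L where *: "set ts \<subseteq> {0..T}"
    "\<And>x. length x = length ts + 1 \<Longrightarrow> \<bar>h x\<bar> \<le> M"
    "\<And>x y. length x = length ts + 1 \<Longrightarrow> length y = length ts + 1 \<Longrightarrow>
      \<bar>h x - h y\<bar> \<le> L * eucl_dist x y"
    "\<And>t w. t \<in> {0..T} \<Longrightarrow> w \<in> path_space T \<Longrightarrow>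
      \<eta> t w = h (t # map (\<lambda>s. apply_bcontfun w (min s t)) ts)"
    using assms unfolding SG0_def C_bLip_def by blast
  have "\<bar>h x - h y\<bar> \<le> \<bar>L\<bar> * eucl_dist x y" if "length x = length ts + 1" "length y = length ts + 1" for x y
    using *(3)[OF that] mult_right_mono[OF abs_ge_self eucl_dist_nonneg, of L x y] by linarith
  with * have "simple_rep T ts h M \<bar>L\<bar> \<eta>" by (simp add: simple_rep_def)
  then show thesis by (rule that)
qed

lemma SG0I:
  assumes "set ts \<subseteq> {0..T}"
    "\<And>x. length x = length ts + 1 \<Longrightarrow> \<bar>h x\<bar> \<le> M"
    "\<And>x y. length x = length ts + 1 \<Longrightarrow> length y = length ts + 1 \<Longrightarrow>
      \<bar>h x - h y\<bar> \<le> L * eucl_dist x y"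
    "\<And>t w. t \<in> {0..T} \<Longrightarrow> w \<in> path_space T \<Longrightarrow>
      \<eta> t w = h (t # map (\<lambda>s. apply_bcontfun w (min s t)) ts)"
  shows "\<eta> \<in> SG0 T"
proof -
  have "h \<in> C_bLip (length ts + 1)"
    unfolding C_bLip_def using assms(2,3) by blast
  then show ?thesis unfolding SG0_def using assms(1,4) by blast
qed

lemma SG0_bounded_lipschitz:
  assumes "\<eta> \<in> SG0 T"
  obtains K where "\<And>t. t \<in> {0..T} \<Longrightarrow> bounded_lipschitz T K (\<eta> t)"
proof -
  obtain ts h M L where rep: "simple_rep T ts h M L \<eta>"
    by (rule SG0E[OF assms])
  note * = simple_repD[OF rep]
  define K where "K = max M (L * real (length ts + 1))"
  have "bounded_lipschitz T K (\<eta> t)" if t: "t \<in> {0..T}" for t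
  proof (rule bounded_lipschitzI)
    fix w w' assume w: "w \<in> path_space T"
    show "\<bar>\<eta> t w\<bar> \<le> K" using *(3,5) t w by (simp add: K_def le_max_iff_disj)
    assume w': "w' \<in> path_space T"
    let ?x = "\<lambda>w. t # map (\<lambda>s. apply_bcontfun w (min s t)) ts"
    have "\<bar>?x w ! i - ?x w' ! i\<bar> \<le> dist w w'" if "i < length (?x w)" for i
      using that dist_bounded[of w _ w'] by (cases i) (auto simp: dist_real_def)
    then have "eucl_dist (?x w) (?x w') \<le> real (length ts + 1) * dist w w'"
      using eucl_dist_le[of "?x w" "?x w'"] by simp
    then have "L * eucl_dist (?x w) (?x w') \<le> L * (real (length ts + 1) * dist w w')"
      using *(2) by (rule mult_left_mono)
    also have "\<dots> = (L * real (length ts + 1)) * dist w w'" by simp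
    also have "\<dots> \<le> K * dist w w'" unfolding K_def by (intro mult_right_mono) auto
    finally show "\<eta> t w \<le> \<eta> t w' + K * dist w w'"
      using *(4)[of "?x w" "?x w'"] *(5)[OF t w] *(5)[OF t w'] by simp
  qed
  then show thesis by (rule that)
qed

lemma SG0_continuous:
  assumes "\<eta> \<in> SG0 T" "w \<in> path_space T"
  shows "continuous_on {0..T} (\<lambda>t. \<eta> t w)"
proof -
  obtain ts h M L where rep: "simple_rep T ts h M L \<eta>"
    by (rule SG0E[OF assms(1)])
  note * = simple_repD[OF rep]
  let ?x = "\<lambda>t. t # map (\<lambda>s. apply_bcontfun w (min s t)) ts"
  have "((\<lambda>t. \<eta> t w) \<longlongrightarrow> \<eta> t0 w) (at t0 within {0..T})" if t0: "t0 \<in> {0..T}" for t0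
  proof -
    have "((\<lambda>t. \<bar>?x t ! i - ?x t0 ! i\<bar>) \<longlongrightarrow> 0) (at t0 within {0..T})" if i: "i < length ts + 1" for i
    proof -
      have "((\<lambda>t. ?x t ! i) \<longlongrightarrow> ?x t0 ! i) (at t0 within {0..T})"
      proof (cases i)
        case (Suc k)
        have "continuous_on {0..T} (\<lambda>t. apply_bcontfun w (min (ts ! k) t))"
          by (rule continuous_on_compose2[OF continuous_on_apply_bcontfun[of UNIV w]])
             (auto intro!: continuous_intros)
        then show ?thesis using Suc i t0 by (simp add: continuous_on_def)
      qed (auto intro: tendsto_intros)
      then show ?thesis by (simp add: tendsto_rabs_zero_iff LIM_zero_iff)
    qed
    then have lim: "((\<lambda>t. L * (\<Sum>i<length ts + 1. \<bar>?x t ! i - ?x t0 ! i\<bar>)) \<longlongrightarrow> 0) (at t0 within {0..T})"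
      by (intro tendsto_mult_right_zero tendsto_null_sum) auto
    have bound: "norm (\<eta> t w - \<eta> t0 w) \<le> L * (\<Sum>i<length ts + 1. \<bar>?x t ! i - ?x t0 ! i\<bar>)"
      if "t \<in> {0..T}" for t
    proof -
      have "\<bar>h (?x t) - h (?x t0)\<bar> \<le> L * eucl_dist (?x t) (?x t0)" by (rule *(4)) auto
      also have "\<dots> \<le> L * (\<Sum>i<length ts + 1. \<bar>?x t ! i - ?x t0 ! i\<bar>)"
        using eucl_dist_le_sum[of "?x t" "?x t0"] *(2) by (intro mult_left_mono) auto
      finally show ?thesis using *(5)[OF that assms(2)] *(5)[OF t0 assms(2)] by simp
    qed
    have "eventually (\<lambda>t. norm (\<eta> t w - \<eta> t0 w) \<le>
        L * (\<Sum>i<length ts + 1. \<bar>?x t ! i - ?x t0 ! i\<bar>)) (at t0 within {0..T})"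
      unfolding eventually_at_filter using bound by (intro always_eventually) blast
    then have "((\<lambda>t. \<eta> t w - \<eta> t0 w) \<longlongrightarrow> 0) (at t0 within {0..T})"
      using lim by (rule Lim_null_comparison)
    then show ?thesis by (simp add: LIM_zero_iff)
  qed
  then show ?thesis by (auto simp: continuous_on_def)
qed

text \<open>Stability under all pointwise operations that are Lipschitz on bounded sets; local Lipschitz
  continuity suffices because simple processes are bounded. It covers powers as well as
  lattice operations. The time coordinate is shared, so the new function splits the list of
  path values after the first \<open>length ts1 + 1\<close> entries and copies the head to the second part.\<close>

lemma SG0_combine:
  assumes "\<eta> \<in> SG0 T" "\<theta> \<in> SG0 T"
    and f: "\<And>M. 0 \<le> M \<Longrightarrow> \<exists>K\<ge>0. \<forall>x y x' y'. \<bar>x\<bar> \<le> M \<longrightarrow> \<bar>y\<bar> \<le> M \<longrightarrow> \<bar>x'\<bar> \<le> M \<longrightarrow> \<bar>y'\<bar> \<le> M \<longrightarrow>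
      \<bar>f x y - f x' y'\<bar> \<le> K * (\<bar>x - x'\<bar> + \<bar>y - y'\<bar>)"
  shows "(\<lambda>t w. f (\<eta> t w) (\<theta> t w)) \<in> SG0 T"
proof -
  obtain ts1 h1 M1 L1 where rep1: "simple_rep T ts1 h1 M1 L1 \<eta>"
    by (rule SG0E[OF assms(1)])
  note 1 = simple_repD[OF rep1]
  obtain ts2 h2 M2 L2 where rep2: "simple_rep T ts2 h2 M2 L2 \<theta>"
    by (rule SG0E[OF assms(2)])
  note 2 = simple_repD[OF rep2]
  define M where "M = max 0 (max M1 M2)"
  obtain K where "K \<ge> 0" and K: "\<And>x y x' y'. \<bar>x\<bar> \<le> M \<Longrightarrow> \<bar>y\<bar> \<le> M \<Longrightarrow> \<bar>x'\<bar> \<le> M \<Longrightarrow> \<bar>y'\<bar> \<le> M \<Longrightarrow>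
      \<bar>f x y - f x' y'\<bar> \<le> K * (\<bar>x - x'\<bar> + \<bar>y - y'\<bar>)"
    using f[of M] by (auto simp: M_def)
  let ?n1 = "length ts1 + 1" and ?n2 = "length ts2 + 1"
  define p1 where "p1 z = take ?n1 z" for z :: "real list"
  define p2 where "p2 z = hd z # drop ?n1 z" for z :: "real list"
  \<comment> \<open>A list of length \<open>n\<close> whose coordinates move by at most \<open>D\<close> moves by at most \<open>n D\<close>.\<close>
  define C where "C = K * (L1 * real ?n1 + L2 * real ?n2)"
  show ?thesis
  proof (rule SG0I[where ts = "ts1 @ ts2" and h = "\<lambda>z. f (h1 (p1 z)) (h2 (p2 z))"
        and M = "\<bar>f 0 0\<bar> + K * (2 * M)" and L = C])
    show "set (ts1 @ ts2) \<subseteq> {0..T}" using 1 2 by auto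
    have len: "length (p1 z) = ?n1" "length (p2 z) = ?n2"
      if "length z = length (ts1 @ ts2) + 1" for z :: "real list"
      using that by (auto simp: p1_def p2_def)
    have bd: "\<bar>h1 (p1 z)\<bar> \<le> M" "\<bar>h2 (p2 z)\<bar> \<le> M" if "length z = length (ts1 @ ts2) + 1" for z
      using 1(3)[OF len(1)[OF that]] 2(3)[OF len(2)[OF that]] by (auto simp: M_def)
    fix x :: "real list" assume x: "length x = length (ts1 @ ts2) + 1"
    have "\<bar>f (h1 (p1 x)) (h2 (p2 x)) - f 0 0\<bar> \<le> K * (\<bar>h1 (p1 x)\<bar> + \<bar>h2 (p2 x)\<bar>)"
      using K[OF bd[OF x], of 0 0] by (simp add: M_def)
    also have "\<dots> \<le> K * (2 * M)" using bd[OF x] \<open>K \<ge> 0\<close> by (intro mult_left_mono) auto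
    finally show "\<bar>f (h1 (p1 x)) (h2 (p2 x))\<bar> \<le> \<bar>f 0 0\<bar> + K * (2 * M)" by linarith
    fix y :: "real list" assume y: "length y = length (ts1 @ ts2) + 1"
    let ?D = "eucl_dist x y"
    have coord: "\<bar>x ! i - y ! i\<bar> \<le> ?D" if "i < length x" for i
      using that by (rule coordinate_le_eucl_dist)
    have "\<bar>p1 x ! i - p1 y ! i\<bar> \<le> ?D" if "i < length (p1 x)" for i
      using that coord x y by (auto simp: p1_def)
    then have "eucl_dist (p1 x) (p1 y) \<le> real ?n1 * ?D"
      using eucl_dist_le[of "p1 x" "p1 y"] len(1)[OF x] by simp
    then have "\<bar>h1 (p1 x) - h1 (p1 y)\<bar> \<le> L1 * (real ?n1 * ?D)"
      using 1(4)[OF len(1)[OF x] len(1)[OF y]] 1(2) mult_left_mono order_trans by blast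
    moreover have "\<bar>p2 x ! i - p2 y ! i\<bar> \<le> ?D" if i: "i < length (p2 x)" for i
    proof (cases i)
      case 0
      have "x \<noteq> []" "y \<noteq> []" using x y by auto
      then show ?thesis using coord[of 0] x 0 by (simp add: p2_def hd_conv_nth)
    next
      case (Suc k)
      then show ?thesis using coord[of "?n1 + k"] i x y by (auto simp: p2_def)
    qed
    then have "eucl_dist (p2 x) (p2 y) \<le> real ?n2 * ?D"
      using eucl_dist_le[of "p2 x" "p2 y"] len(2)[OF x] by simp
    then have "\<bar>h2 (p2 x) - h2 (p2 y)\<bar> \<le> L2 * (real ?n2 * ?D)"
      using 2(4)[OF len(2)[OF x] len(2)[OF y]] 2(2) mult_left_mono order_trans by blast
    ultimately have "K * (\<bar>h1 (p1 x) - h1 (p1 y)\<bar> + \<bar>h2 (p2 x) - h2 (p2 y)\<bar>)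
        \<le> K * (L1 * (real ?n1 * ?D) + L2 * (real ?n2 * ?D))"
      using \<open>K \<ge> 0\<close> by (intro mult_left_mono add_mono) auto
    also have "\<dots> = C * ?D" by (simp add: C_def algebra_simps)
    finally show "\<bar>f (h1 (p1 x)) (h2 (p2 x)) - f (h1 (p1 y)) (h2 (p2 y))\<bar> \<le> C * ?D"
      using K[OF bd[OF x] bd[OF y]] by linarith
  next
    fix t w assume tw: "t \<in> {0..T}" "w \<in> path_space T"
    show "f (\<eta> t w) (\<theta> t w) =
        f (h1 (p1 (t # map (\<lambda>s. apply_bcontfun w (min s t)) (ts1 @ ts2))))
          (h2 (p2 (t # map (\<lambda>s. apply_bcontfun w (min s t)) (ts1 @ ts2))))"
      using 1(5)[OF tw] 2(5)[OF tw] by (simp add: p1_def p2_def)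
  qed
qed

lemma SG0_const: "(\<lambda>t w. c) \<in> SG0 T"
  by (rule SG0I[where ts = "[]" and h = "\<lambda>x. c" and M = "\<bar>c\<bar>" and L = 0]) auto

lemma SG0_min: "\<eta> \<in> SG0 T \<Longrightarrow> \<theta> \<in> SG0 T \<Longrightarrow> (\<lambda>t w. min (\<eta> t w) (\<theta> t w)) \<in> SG0 T"
  by (rule SG0_combine[where f = min]) (auto intro!: exI[of _ 1] simp: min_def)

lemma SG0_max: "\<eta> \<in> SG0 T \<Longrightarrow> \<theta> \<in> SG0 T \<Longrightarrow> (\<lambda>t w. max (\<eta> t w) (\<theta> t w)) \<in> SG0 T"
  by (rule SG0_combine[where f = max]) (auto intro!: exI[of _ 1] simp: max_def)

lemma SG0_diff: "\<eta> \<in> SG0 T \<Longrightarrow> \<theta> \<in> SG0 T \<Longrightarrow> (\<lambda>t w. \<eta> t w - \<theta> t w) \<in> SG0 T"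
  by (rule SG0_combine[where f = "(-)"]) (auto intro!: exI[of _ 1])

lemma SG0_abs_powr:
  assumes "\<eta> \<in> SG0 T" "p \<ge> 1"
  shows "(\<lambda>t w. \<bar>\<eta> t w\<bar> powr p) \<in> SG0 T"
proof (rule SG0_combine[where f = "\<lambda>x y. \<bar>x\<bar> powr p" and \<theta> = \<eta>, OF assms(1,1)])
  fix M :: real assume "0 \<le> M"
  let ?K = "p * M powr (p - 1)"
  have "\<bar>\<bar>x\<bar> powr p - \<bar>x'\<bar> powr p\<bar> \<le> ?K * (\<bar>x - x'\<bar> + \<bar>y - y'\<bar>)"
    if "\<bar>x\<bar> \<le> M" "\<bar>x'\<bar> \<le> M" for x x' y y' :: real
  proof -
    have "\<bar>\<bar>x\<bar> powr p - \<bar>x'\<bar> powr p\<bar> \<le> ?K * \<bar>x - x'\<bar>" using abs_powr_lipschitz assms(2) that by blast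
    also have "\<dots> \<le> ?K * (\<bar>x - x'\<bar> + \<bar>y - y'\<bar>)" using assms(2) by (intro mult_left_mono) auto
    finally show ?thesis .
  qed
  moreover have "?K \<ge> 0" using assms(2) by simp
  ultimately show "\<exists>K\<ge>0. \<forall>x y x' y'. \<bar>x\<bar> \<le> M \<longrightarrow> \<bar>y\<bar> \<le> M \<longrightarrow> \<bar>x'\<bar> \<le> M \<longrightarrow> \<bar>y'\<bar> \<le> M \<longrightarrow>
      \<bar>\<bar>x\<bar> powr p - \<bar>x'\<bar> powr p\<bar> \<le> K * (\<bar>x - x'\<bar> + \<bar>y - y'\<bar>)" by blast
qed

text \<open>Replacing every observation time \<open>s\<close> by \<open>c \<and> s\<close> absorbs the stopping, since
  \<open>s \<and> (c \<and> t) = (c \<and> s) \<and> t\<close>.\<close>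

lemma SG0_stopped:
  assumes "\<eta> \<in> SG0 T" "c \<in> {0..T}"
  shows "(\<lambda>t w. \<eta> (min c t) w) \<in> SG0 T"
proof -
  obtain ts h M L where rep: "simple_rep T ts h M L \<eta>"
    by (rule SG0E[OF assms(1)])
  note * = simple_repD[OF rep]
  let ?q = "\<lambda>z. min c (hd z) # tl z"
  let ?n = "length ts + 1"
  show ?thesis
  proof (rule SG0I[where ts = "map (min c) ts" and h = "\<lambda>z. h (?q z)" and M = M and L = "L * real ?n"])
    show "set (map (min c) ts) \<subseteq> {0..T}" using *(1) assms(2) by auto
    fix x :: "real list" assume x: "length x = length (map (min c) ts) + 1"
    show "\<bar>h (?q x)\<bar> \<le> M" using x by (intro *(3)) auto
    fix y :: "real list" assume y: "length y = length (map (min c) ts) + 1"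
    have "\<bar>?q x ! i - ?q y ! i\<bar> \<le> eucl_dist x y" if i: "i < length (?q x)" for i
    proof (cases i)
      case 0
      have "x \<noteq> []" "y \<noteq> []" using x y by auto
      then have "\<bar>hd x - hd y\<bar> \<le> eucl_dist x y"
        using coordinate_le_eucl_dist[of 0 x y] by (simp add: hd_conv_nth)
      then show ?thesis using 0 by (auto simp: min_def)
    next
      case (Suc k)
      then show ?thesis using coordinate_le_eucl_dist[of i x y] i x y by (simp add: nth_tl)
    qed
    then have "eucl_dist (?q x) (?q y) \<le> real ?n * eucl_dist x y"
      using eucl_dist_le[of "?q x" "?q y"] x by simp
    then have "L * eucl_dist (?q x) (?q y) \<le> L * (real ?n * eucl_dist x y)"
      using *(2) by (rule mult_left_mono)
    moreover have "\<bar>h (?q x) - h (?q y)\<bar> \<le> L * eucl_dist (?q x) (?q y)"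
      using x y by (intro *(4)) auto
    ultimately show "\<bar>h (?q x) - h (?q y)\<bar> \<le> L * real ?n * eucl_dist x y"
      by (simp add: mult.assoc)
  next
    fix t w assume tw: "t \<in> {0..T}" "w \<in> path_space T"
    have "min c t \<in> {0..T}" using tw assms(2) by auto
    from *(5)[OF this tw(2)]
    show "\<eta> (min c t) w = h (?q (t # map (\<lambda>s. apply_bcontfun w (min s t)) (map (min c) ts)))"
      by (simp add: o_def min.assoc min.left_commute)
  qed
qed

lemma SG0_finite_SUP:
  assumes "finite I" "I \<noteq> {}" "\<And>i. i \<in> I \<Longrightarrow> \<eta> i \<in> SG0 T"
  shows "(\<lambda>t w. SUP i\<in>I. \<eta> i t w) \<in> SG0 T"
  using assms
proof (induction I rule: finite_ne_induct)
  case (insert i I)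
  then have "(\<lambda>t w. max (\<eta> i t w) (SUP j\<in>I. \<eta> j t w)) \<in> SG0 T" by (intro SG0_max) auto
  then show ?case using insert by (simp add: cSup_insert sup_max)
qed simp

lemma SG0_finite_INF:
  assumes "finite I" "I \<noteq> {}" "\<And>i. i \<in> I \<Longrightarrow> \<eta> i \<in> SG0 T"
  shows "(\<lambda>t w. INF i\<in>I. \<eta> i t w) \<in> SG0 T"
  using assms
proof (induction I rule: finite_ne_induct)
  case (insert i I)
  then have "(\<lambda>t w. min (\<eta> i t w) (INF j\<in>I. \<eta> j t w)) \<in> SG0 T" by (intro SG0_min) auto
  then show ?case using insert by (simp add: cInf_insert inf_min)
qed simp

lemma grid_sup_min_inf_SG0:
  assumes "T > 0" "a \<in> SG0 T" "b \<in> SG0 T"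
  shows "grid_sup_min_inf T N a b \<in> SG0 T"
proof -
  have grid: "real k * T / real N \<in> {0..T}" if "k \<le> N" for k
    using that assms(1) by (cases "N = 0") (auto simp: field_simps)
  show ?thesis
    unfolding grid_sup_min_inf_def
    by (intro SG0_finite_SUP SG0_min SG0_finite_INF SG0_stopped assms grid) auto
qed

text \<open>This turns the stability properties of simple processes into stability properties of cylinder
  variables.\<close>

lemma SG0_terminal_value_Lip:
  assumes "\<eta> \<in> SG0 T" "T > 0"
  shows "\<eta> T \<in> Lip T T"
proof -
  obtain ts h M L where rep: "simple_rep T ts h M L \<eta>"
    by (rule SG0E[OF assms(1)])
  note * = simple_repD[OF rep]
  let ?n = "length ts + 1"
  have "\<bar>h (T # x) - h (T # y)\<bar> \<le> L * real ?n * (1 + eucl_norm x ^ 0 + eucl_norm y ^ 0) * eucl_dist x y"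
    if x: "length x = length ts" and y: "length y = length ts" for x y
  proof -
    have "\<bar>(T # x) ! i - (T # y) ! i\<bar> \<le> eucl_dist x y" if "i < length (T # x)" for i
      using that coordinate_le_eucl_dist[of _ x y] by (cases i) (auto simp: eucl_dist_nonneg)
    then have "eucl_dist (T # x) (T # y) \<le> real ?n * eucl_dist x y"
      using eucl_dist_le[of "T # x" "T # y"] x by simp
    then have "L * eucl_dist (T # x) (T # y) \<le> L * (real ?n * eucl_dist x y)"
      using *(2) by (rule mult_left_mono)
    also have "\<dots> \<le> 3 * (L * (real ?n * eucl_dist x y))"
      using *(2) eucl_dist_nonneg[of x y] by simp
    finally show ?thesis using *(4)[of "T # x" "T # y"] x y by (simp add: mult_ac)
  qed
  then have "(\<lambda>x. h (T # x)) \<in> C_lLip (length ts)" unfolding C_lLip_def by blast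
  moreover have eq: "map (\<lambda>s. apply_bcontfun w (min s T)) ts = map (apply_bcontfun w) ts" for w
    using *(1) by (auto simp: min_def)
  have "\<forall>w\<in>path_space T. \<eta> T w = h (T # map (apply_bcontfun w) ts)"
    using *(5)[of T] assms(2) by (simp add: eq)
  ultimately show ?thesis
    unfolding Lip_def using *(1) by blast
qed

section \<open>The supremum norm of a process as an element of the completion\<close>

text \<open>The random variable whose expectation is the \<open>p\<close>-th power of the norm on \<open>S\<^sub>G\<^sup>p\<close>.\<close>

definition sup_power :: "real \<Rightarrow> real \<Rightarrow> (real \<Rightarrow> path \<Rightarrow> real) \<Rightarrow> path \<Rightarrow> real" where
  "sup_power T p f w = (SUP t\<in>{0..T}. \<bar>f t w\<bar> powr p)"

lemma bounded_lipschitz_sup_power: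
  assumes "T > 0" "p \<ge> 1" "\<And>t. t \<in> {0..T} \<Longrightarrow> bounded_lipschitz T K (f t)"
  shows "bounded_lipschitz T (max (K powr p) (p * K powr (p - 1) * K)) (sup_power T p f)"
  unfolding sup_power_def using assms
  by (intro bounded_lipschitz_SUP bounded_lipschitz_abs_powr) auto

lemma abs_powr_le_sup_power:
  assumes "p \<ge> 1" "w \<in> path_space T" "\<And>t. t \<in> {0..T} \<Longrightarrow> bounded_lipschitz T K (f t)" "t \<in> {0..T}"
  shows "\<bar>f t w\<bar> powr p \<le> sup_power T p f w"
  unfolding sup_power_def
proof (rule cSUP_upper[OF \<open>t \<in> {0..T}\<close>])
  show "bdd_above ((\<lambda>t. \<bar>f t w\<bar> powr p) ` {0..T})"
    using bounded_lipschitz_bound[OF assms(3) assms(2)] assms(1)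
    by (intro bdd_aboveI2[where M = "K powr p"] powr_mono2) auto
qed

lemma sup_power_nonneg:
  assumes "T > 0" "p \<ge> 1" "w \<in> path_space T" "\<And>t. t \<in> {0..T} \<Longrightarrow> bounded_lipschitz T K (f t)"
  shows "0 \<le> sup_power T p f w"
proof -
  have "\<bar>f 0 w\<bar> powr p \<le> sup_power T p f w"
    using assms(1) by (intro abs_powr_le_sup_power[OF assms(2,3,4)]) auto
  moreover have "0 \<le> \<bar>f 0 w\<bar> powr p" by simp
  ultimately show ?thesis by linarith
qed

lemma abs_le_sup_power_root:
  fixes p x y z :: real
  assumes "p \<ge> 1" "\<bar>x\<bar> powr p \<le> y" "y \<le> z"
  shows "\<bar>x\<bar> \<le> z powr (1 / p)"
proof -
  have "(\<bar>x\<bar> powr p) powr (1 / p) = \<bar>x\<bar>"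
    using assms(1) by (simp add: powr_powr)
  moreover have "(\<bar>x\<bar> powr p) powr (1 / p) \<le> z powr (1 / p)" using assms by (intro powr_mono2) auto
  ultimately show ?thesis by simp
qed

lemma sup_power_le:
  assumes "T > 0" "p \<ge> 1" "\<And>t. t \<in> {0..T} \<Longrightarrow> \<bar>f t w\<bar> \<le> c"
  shows "sup_power T p f w \<le> c powr p"
  unfolding sup_power_def using assms by (intro cSUP_least powr_mono2) auto

lemma bounded_lipschitz_sup_min_inf_process:
  assumes "\<And>t. t \<in> {0..T} \<Longrightarrow> bounded_lipschitz T K (a t)"
    and "\<And>t. t \<in> {0..T} \<Longrightarrow> bounded_lipschitz T K (b t)" and "t \<in> {0..T}"
  shows "bounded_lipschitz T K (sup_min_inf a b t)"
  unfolding sup_min_inf_def using assms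
  by (intro bounded_lipschitz_sup_min_inf) auto

lemma bounded_lipschitz_grid_sup_min_inf:
  assumes "\<And>t. t \<in> {0..T} \<Longrightarrow> bounded_lipschitz T K (a t)"
    and "\<And>t. t \<in> {0..T} \<Longrightarrow> bounded_lipschitz T K (b t)" and "t \<in> {0..T}"
  shows "bounded_lipschitz T K (grid_sup_min_inf T N a b t)"
proof -
  have "min (real k * T / real N) t \<in> {0..T}" for k
    using assms(3) by auto
  then show ?thesis
    unfolding grid_sup_min_inf_def using assms
    by (intro bounded_lipschitz_sup_min_inf) auto
qed

lemma SG0_common_lipschitz:
  assumes "\<eta> \<in> SG0 T" "\<theta> \<in> SG0 T"
  obtains K where "\<And>t. t \<in> {0..T} \<Longrightarrow> bounded_lipschitz T K (\<eta> t)"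
    "\<And>t. t \<in> {0..T} \<Longrightarrow> bounded_lipschitz T K (\<theta> t)"
proof -
  obtain K1 where K1: "\<And>t. t \<in> {0..T} \<Longrightarrow> bounded_lipschitz T K1 (\<eta> t)"
    using SG0_bounded_lipschitz[OF assms(1)] by blast
  obtain K2 where K2: "\<And>t. t \<in> {0..T} \<Longrightarrow> bounded_lipschitz T K2 (\<theta> t)"
    using SG0_bounded_lipschitz[OF assms(2)] by blast
  show thesis
    by (rule that[of "max K1 K2"])
       (auto intro: bounded_lipschitz_mono[OF K1 max.cobounded1] bounded_lipschitz_mono[OF K2 max.cobounded2])
qed

text \<open>The properties of the \<open>G\<close>-expectation that carry the argument.\<close>

locale robust_expectation =
  fixes T :: real and E :: "(path \<Rightarrow> real) \<Rightarrow> real" and \<P> :: "path measure set"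
  assumes T_pos: "T > 0"
    and compact: "compactin (weak_topology T) \<P>"
    and represents: "represents T E \<P>"
    and E_const: "E (\<lambda>w. c) = c"
begin

lemma measures_in_path_probs: "Q \<in> \<P> \<Longrightarrow> Q \<in> path_probs T"
  using compactin_subset_topspace[OF compact] topspace_weak_topology by blast

lemma polar_iff: "polar T \<P> A \<longleftrightarrow> A \<in> sets (path_borel T) \<and> (\<forall>Q\<in>\<P>. emeasure Q A = 0)"
proof -
  have "(SUP Q\<in>\<P>. emeasure Q A) = 0 \<longleftrightarrow> (SUP Q\<in>\<P>. emeasure Q A) \<le> 0" by simp
  also have "\<dots> \<longleftrightarrow> (\<forall>Q\<in>\<P>. emeasure Q A \<le> 0)" by (rule SUP_le_iff)
  finally show ?thesis by (simp add: polar_def)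
qed

lemma polar_empty: "polar T \<P> {}"
  by (simp add: polar_iff)

lemma polar_Un:
  assumes "polar T \<P> A" "polar T \<P> B"
  shows "polar T \<P> (A \<union> B)"
proof -
  have "emeasure Q (A \<union> B) = 0" if "Q \<in> \<P>" for Q
  proof -
    have "sets Q = sets (path_borel T)"
      using measures_in_path_probs[OF that] by (simp add: path_probs_def)
    then have "A \<in> null_sets Q" "B \<in> null_sets Q"
      using assms that by (auto simp: polar_iff null_sets_def)
    then have "A \<union> B \<in> null_sets Q" by (rule null_sets.Un)
    then show ?thesis by auto
  qed
  then show ?thesis using assms by (auto simp: polar_iff)
qed

lemma quasi_surely_everywhere: "(\<And>w. w \<in> path_space T \<Longrightarrow> \<Phi> w) \<Longrightarrow> quasi_surely T \<P> \<Phi>"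
  unfolding quasi_surely_def using polar_empty by blast

lemma quasi_surely_mono:
  assumes "quasi_surely T \<P> \<Phi>" "\<And>w. w \<in> path_space T \<Longrightarrow> \<Phi> w \<Longrightarrow> \<Psi> w"
  shows "quasi_surely T \<P> \<Psi>"
  using assms unfolding quasi_surely_def by blast

lemma quasi_surely_conj:
  assumes "quasi_surely T \<P> \<Phi>" "quasi_surely T \<P> \<Psi>"
  shows "quasi_surely T \<P> (\<lambda>w. \<Phi> w \<and> \<Psi> w)"
proof -
  obtain A where A: "polar T \<P> A" "\<forall>w\<in>path_space T - A. \<Phi> w"
    using assms(1) unfolding quasi_surely_def by blast
  obtain B where B: "polar T \<P> B" "\<forall>w\<in>path_space T - B. \<Psi> w"
    using assms(2) unfolding quasi_surely_def by blast
  show ?thesis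
    unfolding quasi_surely_def using A(2) B(2) by (intro exI[of _ "A \<union> B"] conjI polar_Un[OF A(1) B(1)]) auto
qed

lemma Lip_in_LG1:
  assumes "X \<in> Lip T T"
  shows "X \<in> LG T E \<P> 1"
proof -
  have "LG_norm E 1 (\<lambda>w. X w - X w) = 0" by (simp add: LG_norm_def E_const)
  then have "LG_approx T E \<P> 1 (\<lambda>n. X) X"
    unfolding LG_approx_def using assms by (auto intro: quasi_surely_everywhere)
  then show ?thesis unfolding LG_def by blast
qed

text \<open>For an empty set of measures the supremum would be one fixed number, whereas the expectation
  takes different values on different constants.\<close>

lemma measures_nonempty: "\<P> \<noteq> {}"
proof
  assume "\<P> = {}"
  moreover have "(\<lambda>w. c) \<in> LG T E \<P> 1" for c :: real
    using SG0_terminal_value_Lip[OF SG0_const T_pos, of c] by (rule Lip_in_LG1)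
  ultimately have "E (\<lambda>w. c) = Sup {}" for c
    using represents by (simp add: represents_def)
  from this[of 0] this[of 1] show False by (simp add: E_const)
qed

text \<open>Continuous functionals are Borel measurable, so that completing the measures does not change
  their integrals.\<close>

lemma E_bounded_lipschitz:
  assumes X: "X \<in> LG T E \<P> 1" "bounded_lipschitz T K X"
  shows integral_le_E: "Q \<in> \<P> \<Longrightarrow> (LINT w|Q. X w) \<le> E X"
    and E_le_iff: "E X \<le> d \<longleftrightarrow> (\<forall>Q\<in>\<P>. (LINT w|Q. X w) \<le> d)"
proof -
  have eq: "(LINT w|completion Q. X w) = (LINT w|Q. X w)" if "Q \<in> \<P>" for Q
    using bounded_lipschitz_measurable[OF X(2) measures_in_path_probs[OF that]]
    by (rule integral_completion)
  have bdd: "bdd_above ((\<lambda>Q. LINT w|Q. X w) ` \<P>)" and E: "E X = (SUP Q\<in>\<P>. LINT w|Q. X w)"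
    using represents X(1) eq by (auto simp: represents_def cong: image_cong)
  show "Q \<in> \<P> \<Longrightarrow> (LINT w|Q. X w) \<le> E X"
    unfolding E using bdd by (rule cSUP_upper2) auto
  show "E X \<le> d \<longleftrightarrow> (\<forall>Q\<in>\<P>. (LINT w|Q. X w) \<le> d)"
    unfolding E by (rule cSUP_le_iff[OF measures_nonempty bdd])
qed

text \<open>The terminal values of the grid processes are cylinder variables converging on every path. By the
  Dini argument they are Cauchy: their mutual distance, being a cylinder variable itself, has an
  expectation equal to a supremum of integrals.\<close>

lemma sup_min_inf_in_LG1:
  assumes ab: "a \<in> SG0 T" "b \<in> SG0 T"
  shows "sup_min_inf a b T \<in> LG T E \<P> 1"
proof -
  obtain K where K: "\<And>t. t \<in> {0..T} \<Longrightarrow> bounded_lipschitz T K (a t)"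
    "\<And>t. t \<in> {0..T} \<Longrightarrow> bounded_lipschitz T K (b t)"
    using SG0_common_lipschitz[OF ab] by blast
  have TT: "T \<in> {0..T}" using T_pos by simp
  define X where "X N = grid_sup_min_inf T N a b T" for N
  define F where "F N w = \<bar>X N w - sup_min_inf a b T w\<bar>" for N w
  have X_BL: "bounded_lipschitz T K (X N)" for N
    unfolding X_def by (intro bounded_lipschitz_grid_sup_min_inf K TT)
  have "bounded_lipschitz T (2 * K) (\<lambda>w. X N w - sup_min_inf a b T w)" for N
    by (intro bounded_lipschitz_diff X_BL bounded_lipschitz_sup_min_inf_process K TT)
  from bounded_lipschitz_abs_powr[OF this, of 1]
  have F_BL: "bounded_lipschitz T (2 * K) (F N)" for N
    using bounded_lipschitz_nonneg[OF X_BL[of 0]] unfolding F_def by (cases "K = 0") auto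
  have X_lim: "(\<lambda>N. X N w) \<longlonglongrightarrow> sup_min_inf a b T w" if w: "w \<in> path_space T" for w
  proof (rule LIMSEQ_I)
    fix r :: real assume "r > 0"
    then obtain N0 where "\<forall>N\<ge>N0. \<forall>t\<in>{0..T}.
        \<bar>sup_min_inf a b t w - grid_sup_min_inf T N a b t w\<bar> \<le> r / 2"
      using grid_sup_min_inf_converges[OF T_pos, of "r / 2" a w b] SG0_continuous ab w by auto
    then have "norm (X N w - sup_min_inf a b T w) < r" if "N \<ge> N0" for N
      using that TT \<open>r > 0\<close> unfolding X_def by (force simp: abs_minus_commute)
    then show "\<exists>N0. \<forall>N\<ge>N0. norm (X N w - sup_min_inf a b T w) < r" by blast
  qed
  have "\<exists>N. \<forall>m\<ge>N. \<forall>n\<ge>N. LG_norm E 1 (\<lambda>w. X m w - X n w) < e" if "e > 0" for e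
  proof -
    have "(\<lambda>N. F N w) \<longlonglongrightarrow> 0" if "w \<in> path_space T" for w
      unfolding F_def using X_lim[OF that] by (simp add: LIM_zero tendsto_rabs_zero)
    moreover have "0 \<le> F N w" for N w by (simp add: F_def)
    ultimately have "\<exists>N. \<forall>n\<ge>N. \<forall>Q\<in>\<P>. (LINT w|Q. F n w) \<le> e / 4"
      using \<open>e > 0\<close> F_BL by (intro weakly_compact_dini[OF compact, where K = "2 * K"]) auto
    then obtain N where N: "\<And>n Q. n \<ge> N \<Longrightarrow> Q \<in> \<P> \<Longrightarrow> (LINT w|Q. F n w) \<le> e / 4"
      by blast
    have "LG_norm E 1 (\<lambda>w. X m w - X n w) < e" if mn: "m \<ge> N" "n \<ge> N" for m n
    proof -
      define D where "D w = \<bar>X m w - X n w\<bar> powr 1" for w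
      have "(\<lambda>t w. \<bar>grid_sup_min_inf T m a b t w - grid_sup_min_inf T n a b t w\<bar> powr 1) \<in> SG0 T"
        using ab T_pos by (intro SG0_abs_powr SG0_diff grid_sup_min_inf_SG0) auto
      from SG0_terminal_value_Lip[OF this T_pos]
      have LG: "D \<in> LG T E \<P> 1" unfolding D_def X_def by (rule Lip_in_LG1)
      obtain K' where BL: "bounded_lipschitz T K' D"
        unfolding D_def using bounded_lipschitz_abs_powr[OF bounded_lipschitz_diff[OF X_BL X_BL], of 1]
        by blast
      have "(LINT w|Q. D w) \<le> e / 2" if Q: "Q \<in> \<P>" for Q
      proof -
        note int = bounded_lipschitz_integrable[OF _ measures_in_path_probs[OF Q]]
        have "(LINT w|Q. D w) \<le> (LINT w|Q. F m w + F n w)"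
          by (intro integral_mono Bochner_Integration.integrable_add int[OF BL] int[OF F_BL])
             (auto simp: D_def F_def)
        also have "\<dots> = (LINT w|Q. F m w) + (LINT w|Q. F n w)"
          by (intro Bochner_Integration.integral_add int[OF F_BL])
        also have "\<dots> \<le> e / 2" using N[OF mn(1) Q] N[OF mn(2) Q] by simp
        finally show ?thesis .
      qed
      then have "E D \<le> e / 2" using E_le_iff[OF LG BL] by blast
      moreover have "0 \<le> E D"
      proof -
        obtain Q where Q: "Q \<in> \<P>" using measures_nonempty by blast
        have "0 \<le> (LINT w|Q. D w)" by (simp add: D_def)
        then show ?thesis using integral_le_E[OF LG BL Q] by linarith
      qed
      moreover have "LG_norm E 1 (\<lambda>w. X m w - X n w) = E D powr 1"
        by (simp add: LG_norm_def D_def[abs_def])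
      ultimately show ?thesis using \<open>e > 0\<close> by simp
    qed
    then show ?thesis by blast
  qed
  moreover have "X N \<in> Lip T T" for N
    unfolding X_def by (intro SG0_terminal_value_Lip grid_sup_min_inf_SG0 ab T_pos)
  ultimately have "LG_approx T E \<P> 1 X (sup_min_inf a b T)"
    unfolding LG_approx_def using X_lim quasi_surely_everywhere by auto
  then show ?thesis unfolding LG_def by blast
qed

lemma LG1_cong:
  assumes "X \<in> LG T E \<P> 1" "\<And>w. w \<in> path_space T \<Longrightarrow> X w = Y w"
  shows "Y \<in> LG T E \<P> 1"
proof -
  obtain \<xi> where \<xi>: "LG_approx T E \<P> 1 \<xi> X" using assms(1) by (auto simp: LG_def)
  then have "quasi_surely T \<P> (\<lambda>w. (\<lambda>n. \<xi> n w) \<longlonglongrightarrow> X w)" by (simp add: LG_approx_def)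
  then have "quasi_surely T \<P> (\<lambda>w. (\<lambda>n. \<xi> n w) \<longlonglongrightarrow> Y w)"
    by (rule quasi_surely_mono) (simp add: assms(2))
  with \<xi> have "LG_approx T E \<P> 1 \<xi> Y" by (simp add: LG_approx_def)
  then show ?thesis by (auto simp: LG_def)
qed

text \<open>The running maximum is the case of a constant obstacle above all values of the process: the
  infimum is then inactive.\<close>

lemma sup_power_in_LG1:
  assumes "\<eta> \<in> SG0 T" "p \<ge> 1"
  shows "sup_power T p \<eta> \<in> LG T E \<P> 1"
proof -
  obtain K where K: "\<And>t. t \<in> {0..T} \<Longrightarrow> bounded_lipschitz T K (\<eta> t)"
    using SG0_bounded_lipschitz[OF assms(1)] by blast
  have "sup_min_inf (\<lambda>t w. \<bar>\<eta> t w\<bar> powr p) (\<lambda>t w. K powr p) T w = sup_power T p \<eta> w"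
    if w: "w \<in> path_space T" for w
  proof -
    have "\<bar>\<eta> t w\<bar> powr p \<le> K powr p" if "t \<in> {0..T}" for t
      using bounded_lipschitz_bound[OF K[OF that] w] assms(2) by (intro powr_mono2) auto
    then show ?thesis
      unfolding sup_min_inf_def sup_power_def by (intro SUP_cong) auto
  qed
  moreover have "sup_min_inf (\<lambda>t w. \<bar>\<eta> t w\<bar> powr p) (\<lambda>t w. K powr p) T \<in> LG T E \<P> 1"
    by (intro sup_min_inf_in_LG1 SG0_abs_powr SG0_const assms)
  ultimately show ?thesis by (rule LG1_cong[rotated])
qed

text \<open>Estimates on the norm become estimates on integrals, uniform in the measure, and conversely; the
  later inequalities can then be integrated against one measure at a time.\<close>

lemma SG_norm_bounds:
  assumes \<eta>: "\<eta> \<in> SG0 T" and p: "p \<ge> 1" and "d > 0"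
  shows integral_le_if_SG_norm_less:
      "SG_norm T E p \<eta> < d powr (1 / p) \<Longrightarrow> Q \<in> \<P> \<Longrightarrow> (LINT w|Q. sup_power T p \<eta> w) \<le> d"
    and SG_norm_le_if_integrals_le:
      "(\<And>Q. Q \<in> \<P> \<Longrightarrow> (LINT w|Q. sup_power T p \<eta> w) \<le> d) \<Longrightarrow> SG_norm T E p \<eta> \<le> d powr (1 / p)"
proof -
  obtain K where K: "\<And>t. t \<in> {0..T} \<Longrightarrow> bounded_lipschitz T K (\<eta> t)"
    using SG0_bounded_lipschitz[OF \<eta>] by blast
  note BL = bounded_lipschitz_sup_power[where f = \<eta>, OF T_pos p K]
  note LG = sup_power_in_LG1[OF \<eta> p]
  have norm: "SG_norm T E p \<eta> = E (sup_power T p \<eta>) powr (1 / p)"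
    by (simp add: SG_norm_def sup_power_def[abs_def])
  have nonneg: "0 \<le> (LINT w|Q. sup_power T p \<eta> w)" if "Q \<in> \<P>" for Q
    using sup_power_nonneg[OF T_pos p _ K] path_probs_space[OF measures_in_path_probs[OF that]]
    by (intro integral_nonneg_AE AE_I2) auto
  obtain Q0 where "Q0 \<in> \<P>" using measures_nonempty by blast
  then have E_nonneg: "0 \<le> E (sup_power T p \<eta>)"
    using nonneg integral_le_E[OF LG BL] order_trans by blast
  show "(LINT w|Q. sup_power T p \<eta> w) \<le> d" if "SG_norm T E p \<eta> < d powr (1 / p)" "Q \<in> \<P>"
  proof -
    have "E (sup_power T p \<eta>) < d"
    proof (rule ccontr)
      assume "\<not> ?thesis"
      then have "d powr (1 / p) \<le> E (sup_power T p \<eta>) powr (1 / p)"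
        using \<open>d > 0\<close> p by (intro powr_mono2) auto
      with that(1) norm show False by simp
    qed
    then show ?thesis using integral_le_E[OF LG BL that(2)] by linarith
  qed
  show "SG_norm T E p \<eta> \<le> d powr (1 / p)" if "\<And>Q. Q \<in> \<P> \<Longrightarrow> (LINT w|Q. sup_power T p \<eta> w) \<le> d"
  proof -
    have "E (sup_power T p \<eta>) \<le> d" using E_le_iff[OF LG BL] that by blast
    then show ?thesis unfolding norm using E_nonneg p by (intro powr_mono2) auto
  qed
qed

section \<open>Approximation by simple processes\<close>

lemma sup_min_inf_approximable:
  assumes ab: "a \<in> SG0 T" "b \<in> SG0 T" and p: "p \<ge> 1" and "e > 0"
  shows "\<exists>c\<in>SG0 T. \<forall>Q\<in>\<P>. (LINT w|Q. sup_power T p (\<lambda>t w. sup_min_inf a b t w - c t w) w) \<le> e"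
proof -
  obtain K where K: "\<And>t. t \<in> {0..T} \<Longrightarrow> bounded_lipschitz T K (a t)"
    "\<And>t. t \<in> {0..T} \<Longrightarrow> bounded_lipschitz T K (b t)"
    using SG0_common_lipschitz[OF ab] by blast
  define f where "f N t w = sup_min_inf a b t w - grid_sup_min_inf T N a b t w" for N t w
  have f_BL: "bounded_lipschitz T (2 * K) (f N t)" if "t \<in> {0..T}" for N t
    unfolding f_def using that
    by (intro bounded_lipschitz_diff bounded_lipschitz_sup_min_inf_process
        bounded_lipschitz_grid_sup_min_inf K)
  have lim: "(\<lambda>N. sup_power T p (f N) w) \<longlonglongrightarrow> 0" if w: "w \<in> path_space T" for w
  proof (rule LIMSEQ_I)
    fix r :: real assume "r > 0"
    define d where "d = (r / 2) powr (1 / p)"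
    have "d > 0" "d powr p = r / 2" using \<open>r > 0\<close> p by (auto simp: d_def powr_powr)
    then obtain N0 where N0: "\<And>N t. N \<ge> N0 \<Longrightarrow> t \<in> {0..T} \<Longrightarrow> \<bar>f N t w\<bar> \<le> d"
      unfolding f_def using grid_sup_min_inf_converges[OF T_pos, of d a w b] SG0_continuous ab w
      by blast
    have "norm (sup_power T p (f N) w - 0) < r" if "N \<ge> N0" for N
    proof -
      have "sup_power T p (f N) w \<le> r / 2"
        using sup_power_le[where f = "f N", OF T_pos p N0[OF that]] \<open>d powr p = r / 2\<close> by simp
      moreover have "0 \<le> sup_power T p (f N) w"
        by (rule sup_power_nonneg[OF T_pos p w f_BL])
      ultimately show ?thesis using \<open>r > 0\<close> by simp
    qed
    then show "\<exists>N0. \<forall>N\<ge>N0. norm (sup_power T p (f N) w - 0) < r" by blast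
  qed
  have "\<exists>N. \<forall>n\<ge>N. \<forall>Q\<in>\<P>. (LINT w|Q. sup_power T p (f n) w) \<le> e"
    by (rule weakly_compact_dini[OF compact \<open>e > 0\<close>
          bounded_lipschitz_sup_power[OF T_pos p f_BL] sup_power_nonneg[OF T_pos p _ f_BL] lim])
  then obtain N where "\<forall>Q\<in>\<P>. (LINT w|Q. sup_power T p (f N) w) \<le> e" by blast
  then show ?thesis
    unfolding f_def using grid_sup_min_inf_SG0[OF T_pos ab] by blast
qed

text \<open>A Borel--Cantelli argument: \<open>\<Sum>\<^sub>n D\<^sub>n\<close> has a finite integral under every measure, so it is infinite
  only on a null set, and this set is Borel and does not depend on the measure.\<close>

lemma quasi_surely_tendsto_zero:
  assumes BL: "\<And>n. \<exists>K. bounded_lipschitz T K (D n)"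
    and nonneg: "\<And>n w. w \<in> path_space T \<Longrightarrow> 0 \<le> D n w"
    and small: "\<And>n Q. Q \<in> \<P> \<Longrightarrow> (LINT w|Q. D n w) \<le> (1 / 2) ^ n"
  shows "quasi_surely T \<P> (\<lambda>w. (\<lambda>n. D n w) \<longlonglongrightarrow> 0)"
proof -
  define N where "N = {w \<in> space (path_borel T). (\<Sum>n. ennreal (D n w)) = \<top>}"
  have "D n \<in> borel_measurable (path_borel T)" for n
  proof -
    obtain K where "bounded_lipschitz T K (D n)" using BL by blast
    then have "continuous_on (path_space T) (D n)"
      using lipschitz_on_continuous_on by (auto simp: bounded_lipschitz_def)
    then show ?thesis
      unfolding path_borel_def by (rule borel_measurable_continuous_on_restrict)
  qed
  then have N_meas: "N \<in> sets (path_borel T)" unfolding N_def by measurable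
  have "emeasure Q N = 0" if Q: "Q \<in> \<P>" for Q
  proof -
    note Qp = measures_in_path_probs[OF Q]
    have int: "integrable Q (D n)" for n
      using BL[of n] bounded_lipschitz_integrable[OF _ Qp] by blast
    then have meas: "(\<lambda>w. ennreal (D n w)) \<in> borel_measurable Q" for n by measurable
    have "(\<integral>\<^sup>+ w. (\<Sum>n. ennreal (D n w)) \<partial>Q) = (\<Sum>n. \<integral>\<^sup>+ w. ennreal (D n w) \<partial>Q)"
      using meas by (rule nn_integral_suminf)
    also have "\<dots> \<le> (\<Sum>n. ennreal ((1 / 2) ^ n))"
    proof (rule suminf_le)
      fix n
      have "(\<integral>\<^sup>+ w. ennreal (D n w) \<partial>Q) = ennreal (LINT w|Q. D n w)"
        using int nonneg path_probs_space[OF Qp] by (intro nn_integral_eq_integral) auto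
      also have "\<dots> \<le> ennreal ((1 / 2) ^ n)" using small[OF Q] by (rule ennreal_leI)
      finally show "(\<integral>\<^sup>+ w. ennreal (D n w) \<partial>Q) \<le> ennreal ((1 / 2) ^ n)" .
    qed auto
    also have "\<dots> = ennreal (\<Sum>n. (1 / 2) ^ n)"
      by (intro suminf_ennreal2) auto
    also have "\<dots> < \<top>" by simp
    finally have "(\<integral>\<^sup>+ w. (\<Sum>n. ennreal (D n w)) \<partial>Q) \<noteq> \<infinity>" by simp
    moreover have "(\<lambda>w. \<Sum>n. ennreal (D n w)) \<in> borel_measurable Q" using meas by measurable
    ultimately have "AE w in Q. (\<Sum>n. ennreal (D n w)) \<noteq> \<infinity>" by (intro nn_integral_PInf_AE)
    moreover have "space Q = space (path_borel T)"
      using Qp by (intro sets_eq_imp_space_eq) (simp add: path_probs_def)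
    moreover have "N \<in> sets Q" using N_meas Qp by (simp add: path_probs_def)
    ultimately show ?thesis
      by (subst (asm) AE_iff_measurable[where N = N]) (auto simp: N_def)
  qed
  then have "polar T \<P> N" using N_meas by (simp add: polar_iff)
  moreover have "(\<lambda>n. D n w) \<longlonglongrightarrow> 0" if "w \<in> path_space T - N" for w
  proof -
    have "(\<Sum>n. ennreal (D n w)) \<noteq> \<top>"
      using that by (auto simp: N_def path_borel_def space_restrict_space)
    then have "summable (\<lambda>n. D n w)"
      using nonneg that by (intro summable_suminf_not_top) auto
    then show ?thesis by (rule summable_LIMSEQ_zero)
  qed
  ultimately show ?thesis unfolding quasi_surely_def by blast
qed

text \<open>The diagonal sequence \<open>c\<^sub>n\<close> is compared with \<open>\<gamma>\<close> through \<open>g\<^sub>n\<close>, both in the norm and quasi-surely.\<close>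

lemma sup_min_inf_in_SG:
  assumes p: "p \<ge> 1" and \<alpha>: "\<alpha> \<in> SG T E \<P> p" and \<beta>: "\<beta> \<in> SG T E \<P> p"
  shows "sup_min_inf \<alpha> \<beta> \<in> SG T E \<P> p"
proof -
  obtain a where a: "\<And>n. a n \<in> SG0 T"
    and a_Cauchy: "\<forall>e>0. \<exists>N. \<forall>m\<ge>N. \<forall>n\<ge>N. SG_norm T E p (\<lambda>t w. a m t w - a n t w) < e"
    and a_lim: "quasi_surely T \<P> (\<lambda>w. uniform_limit {0..T} (\<lambda>n t. a n t w) (\<lambda>t. \<alpha> t w) sequentially)"
    using \<alpha> unfolding SG_def by blast
  obtain b where b: "\<And>n. b n \<in> SG0 T"
    and b_Cauchy: "\<forall>e>0. \<exists>N. \<forall>m\<ge>N. \<forall>n\<ge>N. SG_norm T E p (\<lambda>t w. b m t w - b n t w) < e"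
    and b_lim: "quasi_surely T \<P> (\<lambda>w. uniform_limit {0..T} (\<lambda>n t. b n t w) (\<lambda>t. \<beta> t w) sequentially)"
    using \<beta> unfolding SG_def by blast
  define g where "g n = sup_min_inf (a n) (b n)" for n
  have "\<forall>n. \<exists>c. c \<in> SG0 T \<and> (\<forall>Q\<in>\<P>. (LINT w|Q. sup_power T p (\<lambda>t w. g n t w - c t w) w) \<le> (1 / 2) ^ n)"
  proof
    fix n
    show "\<exists>c. c \<in> SG0 T \<and> (\<forall>Q\<in>\<P>. (LINT w|Q. sup_power T p (\<lambda>t w. g n t w - c t w) w) \<le> (1 / 2) ^ n)"
      using sup_min_inf_approximable[OF a b p, of "(1 / 2) ^ n" n n] unfolding g_def by auto
  qed
  then obtain c where c: "\<And>n. c n \<in> SG0 T"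
    and small: "\<And>n Q. Q \<in> \<P> \<Longrightarrow> (LINT w|Q. sup_power T p (\<lambda>t w. g n t w - c n t w) w) \<le> (1 / 2) ^ n"
    using choice[of "\<lambda>n c. c \<in> SG0 T \<and>
      (\<forall>Q\<in>\<P>. (LINT w|Q. sup_power T p (\<lambda>t w. g n t w - c t w) w) \<le> (1 / 2) ^ n)"] by blast
  have "\<forall>n. \<exists>K. \<forall>t\<in>{0..T}. bounded_lipschitz T K (a n t) \<and> bounded_lipschitz T K (b n t) \<and>
      bounded_lipschitz T K (c n t)"
  proof
    fix n
    obtain K1 where K1: "\<And>t. t \<in> {0..T} \<Longrightarrow> bounded_lipschitz T K1 (a n t)"
      "\<And>t. t \<in> {0..T} \<Longrightarrow> bounded_lipschitz T K1 (b n t)"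
      using SG0_common_lipschitz[OF a b] by blast
    obtain K2 where K2: "\<And>t. t \<in> {0..T} \<Longrightarrow> bounded_lipschitz T K2 (c n t)"
      using SG0_bounded_lipschitz[OF c] by blast
    show "\<exists>K. \<forall>t\<in>{0..T}. bounded_lipschitz T K (a n t) \<and> bounded_lipschitz T K (b n t) \<and>
        bounded_lipschitz T K (c n t)"
      by (intro exI[of _ "max K1 K2"] ballI conjI bounded_lipschitz_mono[OF K1(1) max.cobounded1]
          bounded_lipschitz_mono[OF K1(2) max.cobounded1] bounded_lipschitz_mono[OF K2 max.cobounded2])
  qed
  then obtain K where "\<forall>n. \<forall>t\<in>{0..T}. bounded_lipschitz T (K n) (a n t) \<and>
      bounded_lipschitz T (K n) (b n t) \<and> bounded_lipschitz T (K n) (c n t)"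
    by (rule choice[THEN exE])
  then have K: "bounded_lipschitz T (K n) (a n t)" "bounded_lipschitz T (K n) (b n t)"
    "bounded_lipschitz T (K n) (c n t)" if "t \<in> {0..T}" for n t
    using that by simp_all
  have g_BL: "bounded_lipschitz T (K n) (g n t)" if "t \<in> {0..T}" for n t
    unfolding g_def by (intro bounded_lipschitz_sup_min_inf_process K that)
  define D where "D n = sup_power T p (\<lambda>t w. g n t w - c n t w)" for n
  define A where "A m n = sup_power T p (\<lambda>t w. a m t w - a n t w)" for m n
  define B where "B m n = sup_power T p (\<lambda>t w. b m t w - b n t w)" for m n
  define C where "C m n = sup_power T p (\<lambda>t w. c m t w - c n t w)" for m n
  have gc: "bounded_lipschitz T (2 * K n) (\<lambda>w. g n t w - c n t w)" if "t \<in> {0..T}" for n t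
    by (intro bounded_lipschitz_diff g_BL K that)
  have diff: "bounded_lipschitz T (2 * max (K m) (K n)) (\<lambda>w. f m t w - f n t w)"
    if "\<And>n t. t \<in> {0..T} \<Longrightarrow> bounded_lipschitz T (K n) (f n t)" "t \<in> {0..T}" for f m n t
    using that(2) by (intro bounded_lipschitz_diff bounded_lipschitz_mono[OF that(1) max.cobounded1]
        bounded_lipschitz_mono[OF that(1) max.cobounded2])
  have aa: "bounded_lipschitz T (2 * max (K m) (K n)) (\<lambda>w. a m t w - a n t w)"
    and bb: "bounded_lipschitz T (2 * max (K m) (K n)) (\<lambda>w. b m t w - b n t w)"
    and cc: "bounded_lipschitz T (2 * max (K m) (K n)) (\<lambda>w. c m t w - c n t w)"
    if "t \<in> {0..T}" for m n t
    using that by (auto intro!: diff[where f = a] diff[where f = b] diff[where f = c] K)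
  have D_BL: "\<exists>K'. bounded_lipschitz T K' (D n)" for n
    unfolding D_def by (rule exI, rule bounded_lipschitz_sup_power[OF T_pos p gc])
  have ABC_BL: "\<exists>K'. bounded_lipschitz T K' (A m n)" "\<exists>K'. bounded_lipschitz T K' (B m n)"
      "\<exists>K'. bounded_lipschitz T K' (C m n)" for m n
    unfolding A_def B_def C_def
    by (rule exI, rule bounded_lipschitz_sup_power[OF T_pos p aa], assumption)
       (rule exI, rule bounded_lipschitz_sup_power[OF T_pos p bb], assumption,
        rule exI, rule bounded_lipschitz_sup_power[OF T_pos p cc], assumption)
  have D_nonneg: "0 \<le> D n w" if "w \<in> path_space T" for n w
    unfolding D_def by (rule sup_power_nonneg[OF T_pos p that gc])
  have D_ge: "\<bar>g n t w - c n t w\<bar> powr p \<le> D n w" if "w \<in> path_space T" "t \<in> {0..T}" for n t w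
    unfolding D_def by (rule abs_powr_le_sup_power[OF p that(1) gc that(2)])

  \<comment> \<open>With \<open>z\<^sup>p\<close> the sum on the right, each of the three pieces of \<open>c\<^sub>m - c\<^sub>n\<close> is at most \<open>z\<close>.\<close>
  have pointwise: "C m n w \<le> 3 powr p * (D m w + D n w + A m n w + B m n w)"
    if w: "w \<in> path_space T" for m n w
  proof -
    define S where "S = D m w + D n w + A m n w + B m n w"
    define z where "z = S powr (1 / p)"
    have "0 \<le> A m n w" unfolding A_def by (rule sup_power_nonneg[OF T_pos p w aa])
    moreover have "0 \<le> B m n w" unfolding B_def by (rule sup_power_nonneg[OF T_pos p w bb])
    ultimately have nonneg: "0 \<le> D m w" "0 \<le> D n w" "0 \<le> A m n w" "0 \<le> B m n w"
      using D_nonneg[OF w] by auto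
    then have le_S: "D m w \<le> S" "D n w \<le> S" "A m n w \<le> S" "B m n w \<le> S" by (auto simp: S_def)
    have ab_z: "\<bar>a m t w - a n t w\<bar> \<le> z" "\<bar>b m t w - b n t w\<bar> \<le> z" if t: "t \<in> {0..T}" for t
    proof -
      have "\<bar>a m t w - a n t w\<bar> powr p \<le> A m n w"
        unfolding A_def by (rule abs_powr_le_sup_power[OF p w aa t])
      then show "\<bar>a m t w - a n t w\<bar> \<le> z"
        unfolding z_def by (rule abs_le_sup_power_root[OF p _ le_S(3)])
      have "\<bar>b m t w - b n t w\<bar> powr p \<le> B m n w"
        unfolding B_def by (rule abs_powr_le_sup_power[OF p w bb t])
      then show "\<bar>b m t w - b n t w\<bar> \<le> z"
        unfolding z_def by (rule abs_le_sup_power_root[OF p _ le_S(4)])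
    qed
    have bound: "\<bar>a k t w\<bar> \<le> max (K m) (K n)" "\<bar>b k t w\<bar> \<le> max (K m) (K n)"
      if "t \<in> {0..T}" "k \<in> {m, n}" for k t
      using bounded_lipschitz_bound[OF K(1)[OF that(1), of k] w]
        bounded_lipschitz_bound[OF K(2)[OF that(1), of k] w] that(2) by auto
    have "\<bar>c m t w - c n t w\<bar> \<le> 3 * z" if t: "t \<in> {0..T}" for t
    proof -
      have "\<bar>g m t w - g n t w\<bar> \<le> z"
        unfolding g_def by (rule sup_min_inf_diff_le[OF t]) (use bound ab_z in auto)
      moreover have "\<bar>g m t w - c m t w\<bar> \<le> z" "\<bar>g n t w - c n t w\<bar> \<le> z"
        unfolding z_def by (rule abs_le_sup_power_root[OF p D_ge[OF w t] le_S(1)])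
          (rule abs_le_sup_power_root[OF p D_ge[OF w t] le_S(2)])
      ultimately show ?thesis by linarith
    qed
    then have "C m n w \<le> (3 * z) powr p" unfolding C_def by (rule sup_power_le[OF T_pos p])
    also have "\<dots> = 3 powr p * z powr p" by (simp add: powr_mult z_def)
    also have "z powr p = S" using p nonneg by (simp add: z_def powr_powr S_def)
    finally show ?thesis by (simp add: S_def)
  qed

  have "\<exists>N. \<forall>m\<ge>N. \<forall>n\<ge>N. SG_norm T E p (\<lambda>t w. c m t w - c n t w) < e" if "e > 0" for e
  proof -
    \<comment> \<open>Four integrals, each at most \<open>d\<close>, and the factor \<open>3\<^sup>p\<close> from above add up to \<open>(e/2)\<^sup>p\<close>.\<close>
    define d where "d = (e / 2) powr p / 3 powr p / 4"
    have d: "d > 0" using \<open>e > 0\<close> by (simp add: d_def)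
    obtain N1 where N1: "\<And>m n. m \<ge> N1 \<Longrightarrow> n \<ge> N1 \<Longrightarrow>
        SG_norm T E p (\<lambda>t w. a m t w - a n t w) < d powr (1 / p)"
      using a_Cauchy[rule_format, of "d powr (1 / p)"] d by auto
    obtain N2 where N2: "\<And>m n. m \<ge> N2 \<Longrightarrow> n \<ge> N2 \<Longrightarrow>
        SG_norm T E p (\<lambda>t w. b m t w - b n t w) < d powr (1 / p)"
      using b_Cauchy[rule_format, of "d powr (1 / p)"] d by auto
    obtain N3 where N3: "(1 / 2 :: real) ^ N3 < d"
      using real_arch_pow_inv[OF d, of "1 / 2"] by auto
    have "SG_norm T E p (\<lambda>t w. c m t w - c n t w) < e"
      if mn: "m \<ge> max N1 (max N2 N3)" "n \<ge> max N1 (max N2 N3)" for m n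
    proof -
      have "(LINT w|Q. C m n w) \<le> (e / 2) powr p" if Q: "Q \<in> \<P>" for Q
      proof -
        note Qp = measures_in_path_probs[OF Q]
        have int: "integrable Q (D k)" "integrable Q (A m n)" "integrable Q (B m n)" "integrable Q (C m n)" for k
          using D_BL[of k] ABC_BL[of m n] bounded_lipschitz_integrable[OF _ Qp] by blast+
        have D_le: "(LINT w|Q. D k w) \<le> d" if "k \<ge> N3" for k
        proof -
          have "(1 / 2 :: real) ^ k \<le> (1 / 2) ^ N3" using that by (intro power_decreasing) auto
          then show ?thesis using small[OF Q, of k] N3 unfolding D_def by linarith
        qed
        have A_le: "(LINT w|Q. A m n w) \<le> d"
          unfolding A_def using mn
          by (intro integral_le_if_SG_norm_less[OF _ p d _ Q] SG0_diff a N1) auto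
        have B_le: "(LINT w|Q. B m n w) \<le> d"
          unfolding B_def using mn
          by (intro integral_le_if_SG_norm_less[OF _ p d _ Q] SG0_diff b N2) auto
        have "(LINT w|Q. C m n w) \<le> (LINT w|Q. 3 powr p * (D m w + D n w + A m n w + B m n w))"
          using pointwise path_probs_space[OF Qp]
          by (intro integral_mono integrable_mult_right Bochner_Integration.integrable_add int) auto
        also have "\<dots> = 3 powr p * ((LINT w|Q. D m w) + (LINT w|Q. D n w) + (LINT w|Q. A m n w) + (LINT w|Q. B m n w))"
          using int by simp
        also have "\<dots> \<le> 3 powr p * (4 * d)"
          using D_le[of m] D_le[of n] A_le B_le mn by (intro mult_left_mono) auto
        also have "\<dots> = (e / 2) powr p" by (simp add: d_def)
        finally show ?thesis .
      qed
      then have "SG_norm T E p (\<lambda>t w. c m t w - c n t w) \<le> ((e / 2) powr p) powr (1 / p)"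
        using \<open>e > 0\<close> unfolding C_def
        by (intro SG_norm_le_if_integrals_le[OF SG0_diff[OF c c] p]) auto
      also have "\<dots> = e / 2" using p \<open>e > 0\<close> by (simp add: powr_powr)
      also have "\<dots> < e" using \<open>e > 0\<close> by simp
      finally show ?thesis .
    qed
    then show ?thesis by blast
  qed
  moreover have "quasi_surely T \<P>
      (\<lambda>w. uniform_limit {0..T} (\<lambda>n t. c n t w) (\<lambda>t. sup_min_inf \<alpha> \<beta> t w) sequentially)"
  proof -
    have "quasi_surely T \<P> (\<lambda>w. (\<lambda>n. D n w) \<longlonglongrightarrow> 0)"
    proof (rule quasi_surely_tendsto_zero)
      show "\<exists>K. bounded_lipschitz T K (D n)" for n by (rule D_BL)
      show "(LINT w|Q. D n w) \<le> (1 / 2) ^ n" if "Q \<in> \<P>" for n Q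
        unfolding D_def using small[OF that] .
    qed (rule D_nonneg)
    from quasi_surely_conj[OF this quasi_surely_conj[OF a_lim b_lim]]
    show ?thesis
    proof (rule quasi_surely_mono)
      fix w assume w: "w \<in> path_space T"
      assume *: "(\<lambda>n. D n w) \<longlonglongrightarrow> 0 \<and>
        uniform_limit {0..T} (\<lambda>n t. a n t w) (\<lambda>t. \<alpha> t w) sequentially \<and>
        uniform_limit {0..T} (\<lambda>n t. b n t w) (\<lambda>t. \<beta> t w) sequentially"
      show "uniform_limit {0..T} (\<lambda>n t. c n t w) (\<lambda>t. sup_min_inf \<alpha> \<beta> t w) sequentially"
      proof (rule uniform_limitI)
        fix e :: real assume "e > 0"
        define d where "d = e / 3"
        have d: "d > 0" "d powr p > 0" using \<open>e > 0\<close> by (auto simp: d_def)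
        have "eventually (\<lambda>n. D n w < d powr p) sequentially"
          using * d(2) by (auto intro: order_tendstoD)
        moreover have "eventually (\<lambda>n. \<forall>t\<in>{0..T}. dist (a n t w) (\<alpha> t w) < d) sequentially"
          using * d(1) by (auto intro: uniform_limitD)
        moreover have "eventually (\<lambda>n. \<forall>t\<in>{0..T}. dist (b n t w) (\<beta> t w) < d) sequentially"
          using * d(1) by (auto intro: uniform_limitD)
        ultimately show "eventually (\<lambda>n. \<forall>t\<in>{0..T}. dist (c n t w) (sup_min_inf \<alpha> \<beta> t w) < e) sequentially"
        proof eventually_elim
          case (elim n)
          have close: "\<bar>a n t w - \<alpha> t w\<bar> \<le> d" "\<bar>b n t w - \<beta> t w\<bar> \<le> d" if "t \<in> {0..T}" for t
            using elim(2,3) that by (auto simp: dist_real_def less_imp_le)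
          have bound: "\<bar>a n t w\<bar> \<le> K n" "\<bar>b n t w\<bar> \<le> K n" if "t \<in> {0..T}" for t
            using bounded_lipschitz_bound[OF K(1)[OF that] w]
              bounded_lipschitz_bound[OF K(2)[OF that] w] by auto
          have bounds: "\<bar>a n t w\<bar> \<le> K n + d" "\<bar>b n t w\<bar> \<le> K n + d"
            "\<bar>\<alpha> t w\<bar> \<le> K n + d" "\<bar>\<beta> t w\<bar> \<le> K n + d" if "t \<in> {0..T}" for t
            using close[OF that] bound[OF that] d(1) by linarith+
          show ?case
          proof
            fix t assume t: "t \<in> {0..T}"
            have "\<bar>g n t w - sup_min_inf \<alpha> \<beta> t w\<bar> \<le> d"
              unfolding g_def by (rule sup_min_inf_diff_le[OF t, where M = "K n + d"]) (use bounds close in auto)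
            moreover have "\<bar>g n t w - c n t w\<bar> \<le> d"
              using abs_le_sup_power_root[OF p D_ge[OF w t] less_imp_le[OF elim(1)]] p d(1)
              by (simp add: powr_powr)
            ultimately have "\<bar>c n t w - sup_min_inf \<alpha> \<beta> t w\<bar> \<le> 2 * d" by linarith
            then show "dist (c n t w) (sup_min_inf \<alpha> \<beta> t w) < e"
              using \<open>e > 0\<close> by (simp add: dist_real_def d_def)
          qed
        qed
      qed
    qed
  qed
  ultimately show ?thesis unfolding SG_def using c by blast
qed

end

theorem lemma3p3:
  fixes T \<sigma>l \<sigma>u p :: real
    and E :: "(path \<Rightarrow> real) \<Rightarrow> real"
    and \<P> :: "path measure set"
    and \<alpha> \<beta> :: "real \<Rightarrow> path \<Rightarrow> real"
  assumes "T > 0"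
    and "0 \<le> \<sigma>l\<^sup>2" and "\<sigma>l\<^sup>2 < \<sigma>u\<^sup>2"
    and "G_expectation \<sigma>l \<sigma>u T E"
    and "compactin (weak_topology T) \<P>"
    and "extended_to_LG1 T E \<P>"
    and "represents T E \<P>"
    and "p \<ge> 1"
    and "\<alpha> \<in> SG T E \<P> p" and "\<beta> \<in> SG T E \<P> p"
  shows "(\<lambda>t w. SUP s\<in>{0..t}. min (\<alpha> s w) (INF r\<in>{s..t}. \<beta> r w)) \<in> SG T E \<P> p"
proof -
  interpret robust_expectation T E \<P>
  proof
    show "E (\<lambda>w. c) = c" for c
      using assms(4) by (simp add: G_expectation_def sublinear_expectation_def)
  qed (use assms in auto)
  show ?thesis
    using sup_min_inf_in_SG[OF assms(8-10)] by (simp add: sup_min_inf_def[abs_def])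
qed

end
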